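(* Let $0<\delta\le1$, let $w\in A_p$, let $\mathcal A$ satisfy the structural conditions listed in the context, and let $f\in L^1(\Omega)$ be nonnegative (and not identically zero). Then the problem $$-\operatorname{div}(\mathcal A(x,\nabla u))=\frac{f(x)}{u^\delta}\ \text{in }\Omega,\qquad u>0\ \text{in }\Omega,\qquad u=0\ \text{on }\partial\Omega$$ admits at most one weak solution in $W^{1,p}_0(\Omega,w)$.
   Context: Setting: $N\ge 2$, $\Omega\subset\mathbb R^N$ is a bounded smooth domain, $1<p<\infty$. Weights: a locally integrable $w:\mathbb R^N\to(0,\infty)$ (with $0<w<\infty$ a.e.) belongs to $A_p$ if there is $c_{p,w}>0$ such that $\left(\frac1{|B|}\int_B w\,dx\right)\left(\frac1{|B|}\int_B w^{-\frac1{p-1}}dx\right)^{p-1}\le c_{p,w}$ for all balls $B\subset\mathbb R^N$. Spaces: $W^{1,p}(\Omega,w)$ is the space of (weakly differentiable) measurable $u$ with $\|u\|_{1,p,w}=(\int_\Omega|u|^pw\,dx)^{1/p}+(\int_\Omega|\nabla u|^pw\,dx)^{1/p}<\infty$; $X=W^{1,p}_0(\Omega,w)$ is the closure of $C_c^\infty(\Omega)$ in it, and $\left(\int_\Omega|\nabla u|^pw\,dx\right)^{1/p}$ is an equivalent norm on $X$. $u\in W^{1,p}_{loc}(\Omega,w)$ means $u\in W^{1,p}(\Omega',w)$ for every $\Omega'\Subset\Omega$. Operator: $\mathcal A:\Omega\times\mathbb R^N\to\mathbb R^N$ is Carathéodory ($\mathcal A(\cdot,\zeta)$ measurable for every $\zeta$;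 $\mathcal A(x,\cdot)$ continuous for a.e. $x$), and for a.e. $x\in\Omega$ and all vectors in $\mathbb R^N$: (growth) $|\mathcal A(x,\zeta)|\le|\zeta|^{p-1}w(x)$; (degeneracy) $\mathcal A(x,\zeta)\cdot\zeta\ge|\zeta|^pw(x)$; (homogeneity) $\mathcal A(x,t\zeta)=t|t|^{p-2}\mathcal A(x,\zeta)$ for $t\in\mathbb R\setminus\{0\}$; (strong monotonicity) with $\gamma=\max\{p,2\}$ and some constant $c>0$, for $\zeta_1\ne\zeta_2$, $\langle\mathcal A(x,\zeta_1)-\mathcal A(x,\zeta_2),\zeta_1-\zeta_2\rangle\ge c|\zeta_1-\zeta_2|^\gamma\{\overline{\mathcal A}(x,\zeta_1,\zeta_2)\}^{1-\frac\gamma p}w(x)$, where $\overline{\mathcal A}(x,\zeta_1,\zeta_2)=\frac1{w(x)}(\langle\mathcal A(x,\zeta_1),\zeta_1\rangle+\langle\mathcal A(x,\zeta_2),\zeta_2\rangle)$. Weak solution: $u\in W^{1,p}_{loc}(\Omega,w)$ is a weak solution of the problem if for every $K\Subset\Omega$ there is $c_K>0$ with $u\ge c_K$ in $K$; for all $\phi\in C_c^1(\Omega)$, $\int_\Omega\mathcal A(x,\nabla u)\cdot\nabla\phi\,dx=\int_\Omega\frac{f}{u^\delta}\phi\,dx$; $u>0$ in $\Omega$; and $u=0$ on $\partial\Omega$ in the sense that $u^\alpha\in X$ for some $\alpha\ge1$. *)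

theory Defs
  imports "HOL-Analysis.Analysis"
begin

text \<open>Functions on a domain are total functions whose values off the domain are irrelevant, and
  elements of Lebesgue and Sobolev spaces are representatives: pointwise conditions on them
  are understood almost everywhere.\<close>

subsection \<open>Smooth functions and smooth domains\<close>

primrec C_diff :: "nat \<Rightarrow> ('a::euclidean_space \<Rightarrow> real) \<Rightarrow> bool" where
  "C_diff 0 f \<longleftrightarrow> continuous_on UNIV f"
| "C_diff (Suc k) f \<longleftrightarrow> (\<forall>x. f differentiable (at x)) \<and>
     (\<forall>v. C_diff k (\<lambda>x. frechet_derivative f (at x) v))"

definition smooth :: "('a::euclidean_space \<Rightarrow> real) \<Rightarrow> bool" where
  "smooth f \<longleftrightarrow> (\<forall>k. C_diff k f)"

text \<open>Near each boundary point, \<open>\<Omega>\<close> is the region strictly above the graph of a smooth function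
  over the hyperplane orthogonal to some unit vector \<open>e\<close>; \<open>x - (x \<bullet> e) *\<^sub>R e\<close> is the projection
  of \<open>x\<close> to that hyperplane, so only the values of \<open>\<gamma>\<close> there matter.\<close>

definition bounded_smooth_domain :: "'a::euclidean_space set \<Rightarrow> bool" where
  "bounded_smooth_domain \<Omega> \<longleftrightarrow>
     open \<Omega> \<and> connected \<Omega> \<and> \<Omega> \<noteq> {} \<and> bounded \<Omega> \<and>
     (\<forall>z\<in>frontier \<Omega>. \<exists>r>0. \<exists>e \<gamma>. norm e = 1 \<and> smooth \<gamma> \<and>
        \<Omega> \<inter> ball z r = {x \<in> ball z r. \<gamma> (x - (x \<bullet> e) *\<^sub>R e) < x \<bullet> e})"

definition compactly_contained :: "'a::euclidean_space set \<Rightarrow> 'a set \<Rightarrow> bool" where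
  "compactly_contained K \<Omega> \<longleftrightarrow> compact (closure K) \<and> closure K \<subseteq> \<Omega>"

definition Cc1 :: "'a::euclidean_space set \<Rightarrow> ('a \<Rightarrow> real) set" where
  "Cc1 \<Omega> = {\<phi>. C_diff 1 \<phi> \<and> compactly_contained {x. \<phi> x \<noteq> 0} \<Omega>}"

definition Cc_infty :: "'a::euclidean_space set \<Rightarrow> ('a \<Rightarrow> real) set" where
  "Cc_infty \<Omega> = {\<phi>. smooth \<phi> \<and> compactly_contained {x. \<phi> x \<noteq> 0} \<Omega>}"

definition grad :: "('a::euclidean_space \<Rightarrow> real) \<Rightarrow> 'a \<Rightarrow> 'a" where
  "grad f x = (THE D. GDERIV f x :> D)"


subsection \<open>Muckenhoupt weights\<close>

definition locally_integrable_on ::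
    "('a::euclidean_space \<Rightarrow> 'b::euclidean_space) \<Rightarrow> 'a set \<Rightarrow> bool"  (infix "locally'_integrable'_on" 46)
  where
  "f locally_integrable_on \<Omega> \<longleftrightarrow> (\<forall>K. compact K \<and> K \<subseteq> \<Omega> \<longrightarrow> f absolutely_integrable_on K)"

text \<open>Integrability of \<open>w\<close> to the power \<open>-1/(p-1)\<close> on balls is part of the \<open>A\<^sub>p\<close> inequality
  (finiteness of the left-hand side); it is explicit here because the Bochner integral of a
  non-integrable function is \<open>0\<close>.\<close>

definition A_weight :: "real \<Rightarrow> ('a::euclidean_space \<Rightarrow> real) \<Rightarrow> bool" where
  "A_weight p w \<longleftrightarrow>
     w locally_integrable_on UNIV \<and> (AE x in lebesgue. 0 < w x) \<and>
     (\<exists>c>0. \<forall>z. \<forall>r>0.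
        integrable (lebesgue_on (ball z r)) (\<lambda>x. w x powr (- 1 / (p - 1))) \<and>
        ((LINT x|lebesgue_on (ball z r). w x) / measure lebesgue (ball z r)) *
        ((LINT x|lebesgue_on (ball z r). w x powr (- 1 / (p - 1)))
            / measure lebesgue (ball z r)) powr (p - 1) \<le> c)"


subsection \<open>Weighted Sobolev spaces\<close>

definition has_weak_gradient ::
    "'a::euclidean_space set \<Rightarrow> ('a \<Rightarrow> real) \<Rightarrow> ('a \<Rightarrow> 'a) \<Rightarrow> bool" where
  "has_weak_gradient \<Omega> u g \<longleftrightarrow>
     u locally_integrable_on \<Omega> \<and> g locally_integrable_on \<Omega> \<and>
     (\<forall>\<phi>\<in>Cc_infty \<Omega>. \<forall>b\<in>Basis.
        (LINT x|lebesgue_on \<Omega>. u x * (grad \<phi> x \<bullet> b)) =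
        - (LINT x|lebesgue_on \<Omega>. (g x \<bullet> b) * \<phi> x))"

definition weakly_differentiable :: "'a::euclidean_space set \<Rightarrow> ('a \<Rightarrow> real) \<Rightarrow> bool" where
  "weakly_differentiable \<Omega> u \<longleftrightarrow> (\<exists>g. has_weak_gradient \<Omega> u g)"

text \<open>The weak gradient is unique up to null sets; \<open>weak_grad\<close> selects a representative.\<close>

definition weak_grad :: "'a::euclidean_space set \<Rightarrow> ('a \<Rightarrow> real) \<Rightarrow> 'a \<Rightarrow> 'a" where
  "weak_grad \<Omega> u = (SOME g. has_weak_gradient \<Omega> u g)"

definition W1p :: "real \<Rightarrow> ('a::euclidean_space \<Rightarrow> real) \<Rightarrow> 'a set \<Rightarrow> ('a \<Rightarrow> real) set" where
  "W1p p w \<Omega> = {u. u \<in> borel_measurable (lebesgue_on \<Omega>) \<and> weakly_differentiable \<Omega> u \<and>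
     integrable (lebesgue_on \<Omega>) (\<lambda>x. \<bar>u x\<bar> powr p * w x) \<and>
     integrable (lebesgue_on \<Omega>) (\<lambda>x. norm (weak_grad \<Omega> u x) powr p * w x)}"

definition norm_W1p ::
    "real \<Rightarrow> ('a::euclidean_space \<Rightarrow> real) \<Rightarrow> 'a set \<Rightarrow> ('a \<Rightarrow> real) \<Rightarrow> real" where
  "norm_W1p p w \<Omega> u =
     (LINT x|lebesgue_on \<Omega>. \<bar>u x\<bar> powr p * w x) powr (1 / p) +
     (LINT x|lebesgue_on \<Omega>. norm (weak_grad \<Omega> u x) powr p * w x) powr (1 / p)"

definition W1p_0 :: "real \<Rightarrow> ('a::euclidean_space \<Rightarrow> real) \<Rightarrow> 'a set \<Rightarrow> ('a \<Rightarrow> real) set" where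
  "W1p_0 p w \<Omega> =
     {u \<in> W1p p w \<Omega>. \<forall>\<epsilon>>0. \<exists>\<phi>\<in>Cc_infty \<Omega>. norm_W1p p w \<Omega> (\<lambda>x. u x - \<phi> x) < \<epsilon>}"

definition W1p_loc :: "real \<Rightarrow> ('a::euclidean_space \<Rightarrow> real) \<Rightarrow> 'a set \<Rightarrow> ('a \<Rightarrow> real) set" where
  "W1p_loc p w \<Omega> = {u. \<forall>\<Omega>'. open \<Omega>' \<and> compactly_contained \<Omega>' \<Omega> \<longrightarrow> u \<in> W1p p w \<Omega>'}"


subsection \<open>The operator and weak solutions\<close>

definition Caratheodory ::
    "'a::euclidean_space set \<Rightarrow> ('a \<Rightarrow> 'a \<Rightarrow> 'a) \<Rightarrow> bool" where
  "Caratheodory \<Omega> \<A> \<longleftrightarrow>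
     (\<forall>\<zeta>. (\<lambda>x. \<A> x \<zeta>) \<in> borel_measurable (lebesgue_on \<Omega>)) \<and>
     (AE x in lebesgue_on \<Omega>. continuous_on UNIV (\<A> x))"

definition A_bar ::
    "('a::euclidean_space \<Rightarrow> real) \<Rightarrow> ('a \<Rightarrow> 'a \<Rightarrow> 'a) \<Rightarrow> 'a \<Rightarrow> 'a \<Rightarrow> 'a \<Rightarrow> real" where
  "A_bar w \<A> x \<zeta>\<^sub>1 \<zeta>\<^sub>2 = 1 / w x * (\<A> x \<zeta>\<^sub>1 \<bullet> \<zeta>\<^sub>1 + \<A> x \<zeta>\<^sub>2 \<bullet> \<zeta>\<^sub>2)"

definition structural_conditions ::
    "real \<Rightarrow> ('a::euclidean_space \<Rightarrow> real) \<Rightarrow> 'a set \<Rightarrow> ('a \<Rightarrow> 'a \<Rightarrow> 'a) \<Rightarrow> bool" where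
  "structural_conditions p w \<Omega> \<A> \<longleftrightarrow>
     Caratheodory \<Omega> \<A> \<and>
     (AE x in lebesgue_on \<Omega>. \<forall>\<zeta>. norm (\<A> x \<zeta>) \<le> norm \<zeta> powr (p - 1) * w x) \<and>
     (AE x in lebesgue_on \<Omega>. \<forall>\<zeta>. \<A> x \<zeta> \<bullet> \<zeta> \<ge> norm \<zeta> powr p * w x) \<and>
     (AE x in lebesgue_on \<Omega>. \<forall>\<zeta> t. t \<noteq> 0 \<longrightarrow>
        \<A> x (t *\<^sub>R \<zeta>) = (t * \<bar>t\<bar> powr (p - 2)) *\<^sub>R \<A> x \<zeta>) \<and>
     (let \<gamma> = max p 2 in
      \<exists>c>0. AE x in lebesgue_on \<Omega>. \<forall>\<zeta>\<^sub>1 \<zeta>\<^sub>2. \<zeta>\<^sub>1 \<noteq> \<zeta>\<^sub>2 \<longrightarrow>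
        (\<A> x \<zeta>\<^sub>1 - \<A> x \<zeta>\<^sub>2) \<bullet> (\<zeta>\<^sub>1 - \<zeta>\<^sub>2) \<ge>
        c * norm (\<zeta>\<^sub>1 - \<zeta>\<^sub>2) powr \<gamma> * A_bar w \<A> x \<zeta>\<^sub>1 \<zeta>\<^sub>2 powr (1 - \<gamma> / p) * w x)"

text \<open>Both integrands in the weak formulation are integrable by the other hypotheses
  (growth, \<open>u \<in> W1p_loc\<close>, the local lower bounds on \<open>u\<close> and \<open>f \<in> L\<^sup>1\<close>).\<close>

definition weak_solution ::
    "real \<Rightarrow> real \<Rightarrow> ('a::euclidean_space \<Rightarrow> real) \<Rightarrow> 'a set \<Rightarrow> ('a \<Rightarrow> 'a \<Rightarrow> 'a)
      \<Rightarrow> ('a \<Rightarrow> real) \<Rightarrow> ('a \<Rightarrow> real) \<Rightarrow> bool" where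
  "weak_solution p \<delta> w \<Omega> \<A> f u \<longleftrightarrow>
     u \<in> W1p_loc p w \<Omega> \<and>
     (\<forall>K. compactly_contained K \<Omega> \<longrightarrow> (\<exists>c>0. AE x in lebesgue. x \<in> K \<longrightarrow> u x \<ge> c)) \<and>
     (\<forall>\<phi>\<in>Cc1 \<Omega>.
        (LINT x|lebesgue_on \<Omega>. \<A> x (weak_grad \<Omega> u x) \<bullet> grad \<phi> x) =
        (LINT x|lebesgue_on \<Omega>. f x / u x powr \<delta> * \<phi> x)) \<and>
     (AE x in lebesgue_on \<Omega>. u x > 0) \<and>
     (\<exists>\<alpha>\<ge>1. (\<lambda>x. u x powr \<alpha>) \<in> W1p_0 p w \<Omega>)"

end

theory Submission
  imports Defs
begin

text \<open>Put \<open>z = u - v\<close> and let \<open>\<theta>\<close> be a bounded \<open>C\<^sup>1\<close> function that vanishes on \<open>(-\<infinity>, 0]\<close> and has a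
  bounded derivative that is positive on \<open>(0, \<infinity>)\<close>. The natural test function \<open>\<theta>(z)\<^sup>2\<close> is not
  admissible, and mollifying it in a weighted space would need the maximal function. Instead take
  \<open>\<zeta>\<^sub>n \<in> C\<^sub>c\<^sup>1\<close> with \<open>\<zeta>\<^sub>n \<rightarrow> z\<close> in \<open>W\<^sup>1\<^sup>,\<^sup>p(\<Omega>, w)\<close> and almost everywhere, and test the difference of the two
  equations with \<open>\<theta>(\<zeta>\<^sub>n) \<theta>(\<zeta>\<^sub>m)\<close>. On the support of \<open>\<zeta>\<^sub>n\<close> the right-hand side
  \<open>f (u\<^sup>-\<^sup>\<delta> - v\<^sup>-\<^sup>\<delta>)\<close> is integrable, and it is nonpositive where \<open>z > 0\<close>; hence after \<open>m \<rightarrow> \<infinity>\<close> it only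
  contributes a nonpositive term, and \<open>n \<rightarrow> \<infinity>\<close> gives
  \<open>\<integral> (\<A>(x,\<nabla>u) - \<A>(x,\<nabla>v)) \<bullet> \<nabla>z \<theta>(z) \<theta>'(z) \<le> 0\<close>. By strict monotonicity \<open>\<nabla>z = 0\<close> where \<open>z > 0\<close>.
  Finally, for a unit vector \<open>b\<close>,
  \<open>\<integral> \<theta>(\<zeta>\<^sub>n) = - \<integral> (x \<bullet> b) \<theta>'(\<zeta>\<^sub>n) (\<nabla>\<zeta>\<^sub>n \<bullet> b) \<rightarrow> - \<integral> (x \<bullet> b) \<theta>'(z) (\<nabla>z \<bullet> b) = 0\<close>, so \<open>z \<le> 0\<close>;
  exchange \<open>u\<close> and \<open>v\<close>.\<close>

subsection \<open>Differentiable functions and smooth bumps\<close>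

lemma GDERIV_unique:
  assumes "GDERIV f x :> D" "GDERIV f x :> E"
  shows "D = E"
proof -
  have "(\<lambda>h. h \<bullet> D) = (\<lambda>h. h \<bullet> E)"
    using assms unfolding gderiv_def by (rule has_derivative_unique)
  then have "(D - E) \<bullet> D = (D - E) \<bullet> E" by (rule fun_cong)
  then have "(D - E) \<bullet> (D - E) = 0" by (simp add: inner_diff_right)
  then show ?thesis by simp
qed

text \<open>\<open>grad\<close> is a definite description, so it carries information only once the
  gradient is known to be unique; later computations of gradients go through this rule.\<close>

lemma grad_eqI: "GDERIV f x :> D \<Longrightarrow> grad f x = D"
  unfolding grad_def by (blast intro: the_equality GDERIV_unique)

text \<open>Riesz representation in coordinates: a linear functional is the inner product with the
  vector of its values on the basis.\<close>

lemma GDERIV_frechet: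
  fixes f :: "'a::euclidean_space \<Rightarrow> real"
  assumes "f differentiable (at x)"
  shows "GDERIV f x :> (\<Sum>b\<in>Basis. frechet_derivative f (at x) b *\<^sub>R b)"
proof -
  have d: "(f has_derivative frechet_derivative f (at x)) (at x)"
    using assms frechet_derivative_works by blast
  then interpret linear "frechet_derivative f (at x)" by (rule has_derivative_linear)
  have "frechet_derivative f (at x) h = h \<bullet> (\<Sum>b\<in>Basis. frechet_derivative f (at x) b *\<^sub>R b)" for h
  proof -
    have "frechet_derivative f (at x) h = frechet_derivative f (at x) (\<Sum>b\<in>Basis. (h \<bullet> b) *\<^sub>R b)"
      by (simp add: euclidean_representation)
    also have "\<dots> = (\<Sum>b\<in>Basis. (h \<bullet> b) * frechet_derivative f (at x) b)"
      by (simp add: sum scaleR)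
    finally show ?thesis by (simp add: inner_sum_right mult.commute)
  qed
  then have "frechet_derivative f (at x) =
      (\<lambda>h. h \<bullet> (\<Sum>b\<in>Basis. frechet_derivative f (at x) b *\<^sub>R b))"
    by (rule ext)
  \<comment> \<open>The derivative occurs on both sides of the equation, so it is replaced exactly
    once, in an explicit context.\<close>
  then show ?thesis using d unfolding gderiv_def
    by (rule subst[where P="\<lambda>g. (f has_derivative g) (at x)"])
qed

lemma GDERIV_grad:
  fixes f :: "'a::euclidean_space \<Rightarrow> real"
  shows "f differentiable (at x) \<Longrightarrow> GDERIV f x :> grad f x"
  using GDERIV_frechet[of f x] grad_eqI[of f x] by simp

text \<open>Uniqueness of derivatives allows any explicit formula in place of
  \<open>frechet_derivative\<close>; the inductions on \<open>k\<close> below run on such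
  formulas.\<close>

lemma C_diff_SucI:
  assumes "\<And>x. (f has_derivative f' x) (at x)" "\<And>v. C_diff k (\<lambda>x. f' x v)"
  shows "C_diff (Suc k) f"
proof -
  have "frechet_derivative f (at x) = f' x" for x
    using frechet_derivative_at[OF assms(1)] by (rule sym)
  then show ?thesis using assms by (auto simp: differentiable_def)
qed

lemma C_diff_SucD:
  assumes "C_diff (Suc k) f"
  shows "(f has_derivative frechet_derivative f (at x)) (at x)"
    and "C_diff k (\<lambda>x. frechet_derivative f (at x) v)"
  using assms frechet_derivative_works by auto

text \<open>The derivative in direction v is the inner product of v with the gradient, so continuity
  in all directions amounts to continuity of \<open>grad f\<close>.\<close>

lemma C_diff_1_iff:
  fixes f :: "'a::euclidean_space \<Rightarrow> real"
  shows "C_diff 1 f \<longleftrightarrow> (\<forall>x. GDERIV f x :> grad f x) \<and> continuous_on UNIV (grad f)"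
proof
  assume f: "C_diff 1 f"
  then have d: "f differentiable (at x)" for x by simp
  have "grad f = (\<lambda>x. \<Sum>b\<in>Basis. frechet_derivative f (at x) b *\<^sub>R b)"
    using GDERIV_frechet[OF d] by (auto intro: grad_eqI)
  moreover have "continuous_on UNIV (\<lambda>x. \<Sum>b\<in>Basis. frechet_derivative f (at x) b *\<^sub>R b)"
    using C_diff_SucD(2)[of 0 f] f by (intro continuous_intros) (simp_all)
  ultimately show "(\<forall>x. GDERIV f x :> grad f x) \<and> continuous_on UNIV (grad f)"
    using GDERIV_grad[OF d] by simp
next
  assume *: "(\<forall>x. GDERIV f x :> grad f x) \<and> continuous_on UNIV (grad f)"
  then show "C_diff 1 f"
    unfolding One_nat_def
    by (intro C_diff_SucI[where f'="\<lambda>x v. v \<bullet> grad f x"])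
      (auto simp: gderiv_def intro: continuous_intros)
qed

lemma C_diff_1I:
  fixes f :: "'a::euclidean_space \<Rightarrow> real"
  assumes "\<And>x. GDERIV f x :> D x" "continuous_on UNIV D"
  shows "C_diff 1 f" "grad f = D"
proof -
  show "grad f = D" using assms grad_eqI by blast
  then show "C_diff 1 f" unfolding C_diff_1_iff using assms by auto
qed

lemma C_diff_lower: "C_diff (Suc k) f \<Longrightarrow> C_diff k f"
proof (induction k arbitrary: f)
  case 0
  then show ?case
    by (auto intro!: continuous_at_imp_continuous_on differentiable_imp_continuous_within)
next
  case (Suc k)
  then have "C_diff (Suc k) (\<lambda>x. frechet_derivative f (at x) v)" for v
    using C_diff_SucD by blast
  then have "C_diff k (\<lambda>x. frechet_derivative f (at x) v)" for v
    using Suc.IH by blast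
  then show ?case using Suc.prems by simp
qed

lemma C_diff_const: "C_diff k (\<lambda>x. c)"
proof (induction k arbitrary: c)
  case (Suc k)
  then show ?case by (intro C_diff_SucI[where f'="\<lambda>x v. 0"]) auto
qed simp

lemma C_diff_add: "C_diff k f \<Longrightarrow> C_diff k g \<Longrightarrow> C_diff k (\<lambda>x. f x + g x)"
proof (induction k arbitrary: f g)
  case 0
  then show ?case by (auto intro: continuous_intros)
next
  case (Suc k)
  show ?case
    by (rule C_diff_SucI, rule has_derivative_add[OF C_diff_SucD(1)[OF Suc.prems(1)] C_diff_SucD(1)[OF Suc.prems(2)]])
      (intro Suc.IH C_diff_SucD(2)[OF Suc.prems(1)] C_diff_SucD(2)[OF Suc.prems(2)])
qed

text \<open>The product rule pairs a derivative of order \<open>k\<close> with an undifferentiated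
  factor of order \<open>Suc k\<close>; \<open>C_diff_lower\<close> brings the latter down so that
  the induction hypothesis covers both products.\<close>

lemma C_diff_mult: "C_diff k f \<Longrightarrow> C_diff k g \<Longrightarrow> C_diff k (\<lambda>x. f x * g x)"
proof (induction k arbitrary: f g)
  case 0
  then show ?case by (auto intro: continuous_intros)
next
  case (Suc k)
  show ?case
  proof (rule C_diff_SucI)
    show "((\<lambda>x. f x * g x) has_derivative
        (\<lambda>h. f x * frechet_derivative g (at x) h + frechet_derivative f (at x) h * g x)) (at x)" for x
      by (rule has_derivative_mult) (rule C_diff_SucD Suc.prems)+
    show "C_diff k (\<lambda>x. f x * frechet_derivative g (at x) v + frechet_derivative f (at x) v * g x)" for v
      using Suc.prems
      by (intro C_diff_add Suc.IH C_diff_SucD[OF Suc.prems(1)] C_diff_SucD[OF Suc.prems(2)]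
        C_diff_lower[of k])
  qed
qed

lemma smooth_mult: "smooth f \<Longrightarrow> smooth g \<Longrightarrow> smooth (\<lambda>x. f x * g x)"
  by (simp add: smooth_def C_diff_mult)

lemma smooth_prod: "(\<And>i. i \<in> I \<Longrightarrow> smooth (f i)) \<Longrightarrow> smooth (\<lambda>x. \<Prod>i\<in>I. f i x)"
  by (induction I rule: infinite_finite_induct)
    (auto intro: smooth_mult, auto simp: smooth_def intro: C_diff_const)

text \<open>A family of functions, smooth and flat at \<open>0\<close>, that is closed under differentiation.\<close>

definition flat :: "real poly \<Rightarrow> real \<Rightarrow> real" where
  "flat P t = (if 0 < t then poly P (1 / t) * exp (- (1 / t)) else 0)"

lemma poly_times_exp_neg_tendsto_0:
  "((\<lambda>y. poly P y * exp (- y)) \<longlongrightarrow> (0::real)) at_top"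
proof -
  have "((\<lambda>y. \<Sum>i\<le>degree P. coeff P i * (y ^ i / exp y)) \<longlongrightarrow> (\<Sum>i\<le>degree P. coeff P i * 0)) at_top"
    by (intro tendsto_intros tendsto_power_div_exp_0)
  then show ?thesis
    by (simp add: poly_altdef sum_distrib_right exp_minus divide_inverse mult.assoc)
qed

text \<open>With y = 1/t, the derivative of P(y) e^(-y) is y^2 (P(y) - P'(y)) e^(-y), again of the
  same form. Only t = 0 needs a limit of difference quotients.\<close>

lemma DERIV_flat: "(flat P has_real_derivative flat (monom 1 2 * (P - pderiv P)) t) (at t)"
proof -
  consider "t > 0" | "t < 0" | "t = 0" by linarith
  then show ?thesis
  proof cases
    case 1
    have "((\<lambda>t. poly P (1 / t) * exp (- (1 / t))) has_real_derivative
        flat (monom 1 2 * (P - pderiv P)) t) (at t)"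
      using 1 by (auto intro!: derivative_eq_intros DERIV_chain'[OF _ poly_DERIV]
        simp: flat_def poly_monom field_simps power2_eq_square)
    then show ?thesis
      by (rule has_field_derivative_transform_within_open[where S="{0<..}"])
        (use 1 in \<open>auto simp: flat_def\<close>)
  next
    case 2
    have "((\<lambda>t. 0) has_real_derivative flat (monom 1 2 * (P - pderiv P)) t) (at t)"
      using 2 by (simp add: flat_def)
    then show ?thesis
      by (rule has_field_derivative_transform_within_open[where S="{..<0}"])
        (use 2 in \<open>auto simp: flat_def\<close>)
  next
    case 3
    have "((\<lambda>h. flat P h / h) \<longlongrightarrow> 0) (at_left 0)"
      by (rule tendsto_eventually) (auto simp: flat_def eventually_at_filter)
    \<comment> \<open>For h = 1/y, division by h is multiplication by y, and
      \<open>pCons 0 P\<close> is the polynomial y P(y).\<close>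
    moreover have "((\<lambda>y. flat P (inverse y) / inverse y) \<longlongrightarrow> 0) at_top"
      using poly_times_exp_neg_tendsto_0[of "pCons 0 P"]
    proof (rule Lim_transform_eventually)
      show "\<forall>\<^sub>F y in at_top. poly (pCons 0 P) y * exp (- y) = flat P (inverse y) / inverse y"
        using eventually_gt_at_top[of 0] by eventually_elim (auto simp: flat_def field_simps)
    qed
    then have "((\<lambda>h. flat P h / h) \<longlongrightarrow> 0) (at_right 0)"
      by (simp add: filterlim_at_right_to_top)
    ultimately have "((\<lambda>h. flat P h / h) \<longlongrightarrow> 0) (at 0)"
      by (simp add: filterlim_split_at)
    then show ?thesis
      using 3 by (simp add: DERIV_def flat_def)
  qed
qed

lemma continuous_flat: "continuous_on S (flat P)"
  by (rule DERIV_continuous_on, rule has_field_derivative_at_within, rule DERIV_flat)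

text \<open>The induction runs over all \<open>P\<close> at once, because each derivative is another
  member of the family times the constant \<open>h \<bullet> c\<close>.\<close>

lemma smooth_flat_affine: "smooth (\<lambda>x::'a::euclidean_space. flat P (a + x \<bullet> c))"
proof -
  have "C_diff k (\<lambda>x::'a. flat P (a + x \<bullet> c))" for k
  proof (induction k arbitrary: P)
    case 0
    then show ?case
      by (auto intro!: continuous_on_compose2[OF continuous_flat] continuous_intros)
  next
    case (Suc k)
    show ?case
    proof (rule C_diff_SucI)
      show "((\<lambda>x::'a. flat P (a + x \<bullet> c)) has_derivative
          (\<lambda>h. flat (monom 1 2 * (P - pderiv P)) (a + x \<bullet> c) * (h \<bullet> c))) (at x)" for x
        by (rule DERIV_compose_FDERIV[OF DERIV_flat, THEN has_derivative_eq_rhs])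
          (auto intro!: derivative_eq_intros)
    qed (intro C_diff_mult Suc.IH C_diff_const)
  qed
  then show ?thesis by (simp add: smooth_def)
qed

text \<open>This is the \<theta> of the overview: exp(-1/t) for t > 0. The polynomial in
  \<open>dstep\<close> is the one that \<open>DERIV_flat\<close> yields for P = 1.\<close>

definition step :: "real \<Rightarrow> real" where "step = flat 1"
definition dstep :: "real \<Rightarrow> real" where "dstep = flat (monom 1 2)"

lemma DERIV_step: "(step has_real_derivative dstep t) (at t)"
  using DERIV_flat[of 1 t] by (simp add: step_def dstep_def)

lemma continuous_step: "continuous_on S step" "continuous_on S dstep"
  by (simp_all add: step_def dstep_def continuous_flat)

lemma step_nonpos: "t \<le> 0 \<Longrightarrow> step t = 0" "t \<le> 0 \<Longrightarrow> dstep t = 0"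
  by (simp_all add: step_def dstep_def flat_def)

lemma step_pos: "0 < t \<Longrightarrow> 0 < step t" "0 < t \<Longrightarrow> 0 < dstep t"
  by (simp_all add: step_def dstep_def flat_def poly_monom)

lemma step_bounds: "0 \<le> step t" "step t \<le> 1" "0 \<le> dstep t" "dstep t \<le> 2"
proof -
  show "0 \<le> step t" "step t \<le> 1" "0 \<le> dstep t"
    by (simp_all add: step_def dstep_def flat_def poly_monom)
  show "dstep t \<le> 2"
  proof (cases "0 < t")
    case True
    \<comment> \<open>In this variable the derivative is y^2 / e^y, and the quadratic Taylor
      polynomial of exp bounds it by 2.\<close>
    define y where "y = 1 / t"
    have "y > 0" using True by (simp add: y_def)
    then have "1 + y + y\<^sup>2 / 2 \<le> exp y" by (intro exp_lower_Taylor_quadratic) simp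
    then have "y\<^sup>2 \<le> 2 * exp y" using \<open>y > 0\<close> by simp
    moreover have "dstep t = y\<^sup>2 / exp y"
      using True by (simp add: dstep_def flat_def poly_monom y_def exp_minus divide_inverse)
    ultimately show ?thesis by (simp add: divide_le_eq)
  qed (simp add: step_nonpos)
qed

subsection \<open>Compactly supported functions\<close>

text \<open>The closed support serves for the function and its gradient alike, since off it the
  function vanishes on an open set.\<close>

lemma Cc1_compact_support:
  assumes "\<phi> \<in> Cc1 \<Omega>"
  obtains K where "compact K" "K \<subseteq> \<Omega>" "\<And>x. x \<notin> K \<Longrightarrow> \<phi> x = 0" "\<And>x. x \<notin> K \<Longrightarrow> grad \<phi> x = 0"
proof
  let ?K = "closure {x. \<phi> x \<noteq> 0}"
  show "compact ?K" "?K \<subseteq> \<Omega>" using assms by (auto simp: Cc1_def compactly_contained_def)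
  show 0: "\<phi> x = 0" if "x \<notin> ?K" for x using that closure_subset[of "{x. \<phi> x \<noteq> 0}"] by auto
  show "grad \<phi> x = 0" if "x \<notin> ?K" for x
  proof (rule grad_eqI)
    have "((\<lambda>_. 0) has_derivative (\<lambda>_. 0)) (at x)" by simp
    then have "(\<phi> has_derivative (\<lambda>_. 0)) (at x)"
    proof (rule has_derivative_transform_within_open)
      show "open (- ?K)" "x \<in> - ?K" using that by auto
      show "0 = \<phi> y" if "y \<in> - ?K" for y using 0[of y] that by simp
    qed
    then show "GDERIV \<phi> x :> 0" by (simp add: gderiv_def)
  qed
qed

lemma compactly_containedI:
  assumes "compact K" "K \<subseteq> \<Omega>" "\<And>x. x \<notin> K \<Longrightarrow> \<phi> x = 0"
  shows "compactly_contained {x. \<phi> x \<noteq> 0} \<Omega>"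
proof -
  have "{x. \<phi> x \<noteq> 0} \<subseteq> K" using assms(3) by auto
  then have "closure {x. \<phi> x \<noteq> 0} \<subseteq> K" by (rule closure_minimal) (simp add: assms compact_imp_closed)
  moreover from this have "compact (closure {x. \<phi> x \<noteq> 0})"
    using compact_Int_closed[OF assms(1) closed_closure, of "{x. \<phi> x \<noteq> 0}"] by (simp add: Int_absorb1)
  ultimately show ?thesis using assms(2) unfolding compactly_contained_def by blast
qed

lemma Cc1_gderiv:
  assumes "\<phi> \<in> Cc1 \<Omega>"
  shows "GDERIV \<phi> x :> grad \<phi> x" "continuous_on S (grad \<phi>)" "continuous_on S \<phi>"
proof -
  have 1: "C_diff 1 \<phi>" using assms by (simp add: Cc1_def)
  then show "GDERIV \<phi> x :> grad \<phi> x" "continuous_on S (grad \<phi>)"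
    unfolding C_diff_1_iff by (auto intro: continuous_on_subset)
  show "continuous_on S \<phi>"
    using C_diff_lower[of 0 \<phi>] 1 by (auto intro: continuous_on_subset)
qed

lemma Cc_infty_subset_Cc1: "Cc_infty \<Omega> \<subseteq> Cc1 \<Omega>"
  by (auto simp: Cc_infty_def Cc1_def smooth_def simp del: C_diff.simps)

text \<open>This passes from integrals over the domain to Borel integrals over the whole space,
  where translation invariance is available.\<close>

lemma continuous_compact_support_integral:
  fixes f :: "'a::euclidean_space \<Rightarrow> real"
  assumes f: "continuous_on UNIV f" and K: "compact K" "K \<subseteq> \<Omega>" "\<And>x. x \<notin> K \<Longrightarrow> f x = 0"
    and \<Omega>: "open \<Omega>"
  shows "integrable lborel f" "integrable (lebesgue_on \<Omega>) f"
    "(LINT x|lebesgue_on \<Omega>. f x) = (LINT x|lborel. f x)"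
proof -
  have "integrable lborel (\<lambda>x. indicator K x *\<^sub>R f x)"
    by (intro borel_integrable_compact K continuous_on_subset[OF f]) auto
  moreover have "(\<lambda>x. indicator K x *\<^sub>R f x) = f"
    using K by (auto simp: indicator_def fun_eq_iff)
  ultimately show 1: "integrable lborel f" by simp
  have ind: "(\<lambda>x. indicator \<Omega> x *\<^sub>R f x) = f"
    using K by (auto simp: indicator_def fun_eq_iff)
  have m: "\<Omega> \<inter> space lebesgue \<in> sets lebesgue" using \<Omega> by auto
  show "integrable (lebesgue_on \<Omega>) f"
    unfolding integrable_restrict_space[OF m] ind using 1 by (simp add: integrable_completion)
  show "(LINT x|lebesgue_on \<Omega>. f x) = (LINT x|lborel. f x)"
    unfolding integral_restrict_space[OF m] ind using 1 by (simp add: integral_completion)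
qed

text \<open>On the compact set \<open>K\<close> the continuous factor is bounded and the other one
  is integrable.\<close>

lemma locally_integrable_times_continuous:
  fixes g \<phi> :: "'a::euclidean_space \<Rightarrow> real"
  assumes g: "g locally_integrable_on \<Omega>" and f: "continuous_on UNIV \<phi>"
    and K: "compact K" "K \<subseteq> \<Omega>" "\<And>x. x \<notin> K \<Longrightarrow> \<phi> x = 0" and \<Omega>: "open \<Omega>"
  shows "integrable (lebesgue_on \<Omega>) (\<lambda>x. g x * \<phi> x)"
proof -
  have gK: "integrable lebesgue (\<lambda>x. indicator K x *\<^sub>R g x)"
    using g K by (auto simp: locally_integrable_on_def set_integrable_def)
  have "bounded (\<phi> ` K)"
    by (intro compact_imp_bounded compact_continuous_image continuous_on_subset[OF f] K(1)) auto
  then obtain B where B: "\<And>x. x \<in> K \<Longrightarrow> \<bar>\<phi> x\<bar> \<le> B" by (auto simp: bounded_iff)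
  have \<phi>: "\<phi> \<in> borel_measurable lebesgue"
    using f by (intro measurable_completion) (simp add: borel_measurable_continuous_onI)
  have "integrable lebesgue (\<lambda>x. (indicator K x *\<^sub>R g x) * \<phi> x)"
  proof (rule Bochner_Integration.integrable_bound)
    show "integrable lebesgue (\<lambda>x. B * (indicator K x *\<^sub>R g x))" using gK by simp
    show "(\<lambda>x. (indicator K x *\<^sub>R g x) * \<phi> x) \<in> borel_measurable lebesgue"
      using gK \<phi> by (intro borel_measurable_times) auto
    have "\<bar>\<phi> x\<bar> \<le> \<bar>B\<bar>" if "x \<in> K" for x using B[OF that] by simp
    then show "AE x in lebesgue. norm ((indicator K x *\<^sub>R g x) * \<phi> x) \<le> norm (B * (indicator K x *\<^sub>R g x))"
      by (intro AE_I2) (auto simp: indicator_def abs_mult mult.commute intro: mult_right_mono)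
  qed
  moreover have "(\<lambda>x. (indicator K x *\<^sub>R g x) * \<phi> x) = (\<lambda>x. indicator \<Omega> x *\<^sub>R (g x * \<phi> x))"
    using K by (auto simp: indicator_def fun_eq_iff)
  moreover have m: "\<Omega> \<inter> space lebesgue \<in> sets lebesgue" using \<Omega> by auto
  ultimately show ?thesis
    unfolding integrable_restrict_space[OF m] by simp
qed

text \<open>By translation invariance every difference quotient of \<phi> integrates to 0. The
  quotients tend to the directional derivative, and they are dominated because \<phi> is Lipschitz
  with bounded support.\<close>

lemma integral_grad_eq_0:
  fixes \<phi> :: "'a::euclidean_space \<Rightarrow> real"
  assumes "\<phi> \<in> Cc1 \<Omega>"
  shows "(LINT x|lborel. grad \<phi> x \<bullet> b) = 0"
proof -
  obtain K where K: "compact K" "K \<subseteq> \<Omega>" "\<And>x. x \<notin> K \<Longrightarrow> \<phi> x = 0" "\<And>x. x \<notin> K \<Longrightarrow> grad \<phi> x = 0"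
    by (rule Cc1_compact_support[OF assms], rule that)
  note c = Cc1_gderiv[OF assms]
  obtain R where R: "\<And>x. x \<in> K \<Longrightarrow> norm x \<le> R"
    using compact_imp_bounded[OF K(1)] by (auto simp: bounded_iff)
  have "bounded (grad \<phi> ` K)"
    by (intro compact_imp_bounded compact_continuous_image c K(1))
  then obtain B where "\<And>x. x \<in> K \<Longrightarrow> norm (grad \<phi> x) \<le> B" by (auto simp: bounded_iff)
  \<comment> \<open>The maximum with 0 makes the bound valid off \<open>K\<close>, also when
    \<open>K\<close> is empty.\<close>
  then have B: "norm (grad \<phi> x) \<le> max B 0" for x
    using K(4)[of x] by (cases "x \<in> K") (simp_all add: le_max_iff_disj)
  have lip: "\<bar>\<phi> y - \<phi> x\<bar> \<le> max B 0 * norm (y - x)" for x y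
  proof -
    have "norm (\<phi> y - \<phi> x) \<le> max B 0 * norm (y - x)"
    proof (rule differentiable_bound[of UNIV \<phi> "\<lambda>x h. h \<bullet> grad \<phi> x"])
      show "(\<phi> has_derivative (\<lambda>h. h \<bullet> grad \<phi> x)) (at x within UNIV)" for x
        using c(1) by (simp add: gderiv_def)
      show "onorm (\<lambda>h. h \<bullet> grad \<phi> x) \<le> max B 0" for x
      proof (rule onorm_bound)
        show "norm (h \<bullet> grad \<phi> x) \<le> max B 0 * norm h" for h
          using Cauchy_Schwarz_ineq2[of h "grad \<phi> x"] mult_left_mono[OF B[of x], of "norm h"]
          by (simp add: mult.commute)
      qed simp
    qed auto
    then show ?thesis by simp
  qed
  have int: "integrable lborel \<phi>"
    using continuous_compact_support_integral(1)[OF c(3) K(1) subset_UNIV K(3)] by simp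
  define s where "s n x = (\<phi> (inverse (real (Suc n)) *\<^sub>R b + x) - \<phi> x) / inverse (real (Suc n))" for n x
  have m: "\<phi> \<in> borel_measurable borel" using c(3) by (rule borel_measurable_continuous_onI)
  have s0: "integral\<^sup>L lborel (s n) = 0" for n
  proof -
    let ?t = "inverse (real (Suc n)) *\<^sub>R b"
    have "integrable lborel (\<lambda>x. \<phi> (?t + x))"
      using int m by (subst integrable_distr_eq[of "(+) ?t" lborel borel, symmetric])
        (simp_all add: lborel_distr_plus)
    moreover have "integral\<^sup>L lborel \<phi> = integral\<^sup>L lborel (\<lambda>x. \<phi> (?t + x))"
      using m by (subst integral_distr[of "(+) ?t" lborel borel, symmetric])
        (simp_all add: lborel_distr_plus)
    ultimately show ?thesis using int by (simp add: s_def[abs_def])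
  qed
  have "(\<lambda>n. integral\<^sup>L lborel (s n)) \<longlonglongrightarrow> (LINT x|lborel. grad \<phi> x \<bullet> b)"
  proof (rule integral_dominated_convergence)
    show "(\<lambda>x. grad \<phi> x \<bullet> b) \<in> borel_measurable lborel"
      using c(2) by (simp add: borel_measurable_continuous_onI continuous_on_inner)
    show "s n \<in> borel_measurable lborel" for n
      using c(3) unfolding s_def
      by (auto intro!: borel_measurable_continuous_onI continuous_intros
          continuous_on_compose2[OF c(3)[of UNIV]])
    \<comment> \<open>The shifts have length at most \<open>norm b\<close>, so outside this ball
      both points of the quotient lie off \<open>K\<close>.\<close>
    show "integrable lborel (\<lambda>x. indicator (cball 0 (R + norm b)) x *\<^sub>R (max B 0 * norm b))"
      by (intro borel_integrable_compact) auto
    show "AE x in lborel. (\<lambda>n. s n x) \<longlonglongrightarrow> grad \<phi> x \<bullet> b"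
    proof (rule AE_I2)
      fix x
      have "((\<lambda>t. \<phi> (t *\<^sub>R b + x)) has_real_derivative b \<bullet> grad \<phi> x) (at 0)"
      proof -
        have "(\<phi> has_derivative (\<lambda>h. h \<bullet> grad \<phi> x)) (at (0 *\<^sub>R b + x))"
          using c(1) by (simp add: gderiv_def)
        moreover have "((\<lambda>t. t *\<^sub>R b + x) has_derivative (\<lambda>t. t *\<^sub>R b)) (at 0)"
          by (auto intro!: derivative_eq_intros)
        ultimately have "((\<lambda>t. \<phi> (t *\<^sub>R b + x)) has_derivative (\<lambda>t. (t *\<^sub>R b) \<bullet> grad \<phi> x)) (at 0)"
          by (rule has_derivative_compose[rotated])
        moreover have "(\<lambda>t. (t *\<^sub>R b) \<bullet> grad \<phi> x) = (*) (b \<bullet> grad \<phi> x)"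
          by (simp add: fun_eq_iff)
        ultimately show ?thesis
          unfolding has_field_derivative_def by simp
      qed
      then have "((\<lambda>h. (\<phi> (h *\<^sub>R b + x) - \<phi> x) / h) \<longlongrightarrow> b \<bullet> grad \<phi> x) (at 0)"
        by (simp add: DERIV_def)
      moreover have "filterlim (\<lambda>n. inverse (real (Suc n))) (at 0) sequentially"
        using LIMSEQ_inverse_real_of_nat by (intro filterlim_atI) auto
      ultimately show "(\<lambda>n. s n x) \<longlonglongrightarrow> grad \<phi> x \<bullet> b"
        unfolding s_def inner_commute[of _ b] by (rule filterlim_compose)
    qed
    show "AE x in lborel. norm (s n x) \<le> indicator (cball 0 (R + norm b)) x *\<^sub>R (max B 0 * norm b)" for n
    proof (rule AE_I2)
      fix x
      let ?r = "inverse (real (Suc n))"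
      have r: "0 < ?r" "?r \<le> 1" by (auto simp: field_simps)
      show "norm (s n x) \<le> indicator (cball 0 (R + norm b)) x *\<^sub>R (max B 0 * norm b)"
      proof (cases "x \<in> cball 0 (R + norm b)")
        case True
        have "\<bar>\<phi> (?r *\<^sub>R b + x) - \<phi> x\<bar> \<le> max B 0 * (?r * norm b)"
          using lip[of "?r *\<^sub>R b + x" x] r by simp
        then have "\<bar>\<phi> (?r *\<^sub>R b + x) - \<phi> x\<bar> / ?r \<le> max B 0 * norm b"
          using r(1) by (subst pos_divide_le_eq) (simp_all add: mult_ac)
        then show ?thesis using True r(1) by (simp only: s_def real_norm_def abs_divide abs_of_pos) simp
      next
        case False
        have rb: "norm (?r *\<^sub>R b) \<le> norm b" using r by (simp add: mult_left_le_one_le)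
        have "norm x > R + norm b" using False by simp
        then have "x \<notin> K" "?r *\<^sub>R b + x \<notin> K"
          using R[of x] R[of "?r *\<^sub>R b + x"] rb norm_ge_zero[of b]
            norm_triangle_ineq4[of "?r *\<^sub>R b + x" "?r *\<^sub>R b"] by auto
        then show ?thesis using False K(3) by (simp add: s_def)
      qed
    qed
  qed
  then show ?thesis by (simp add: s0 LIMSEQ_const_iff)
qed

lemma Cc1_mult:
  fixes \<phi> \<eta> :: "'a::euclidean_space \<Rightarrow> real"
  assumes "C_diff 1 \<phi>" "\<eta> \<in> Cc1 \<Omega>"
  shows "(\<lambda>x. \<phi> x * \<eta> x) \<in> Cc1 \<Omega>"
    "grad (\<lambda>x. \<phi> x * \<eta> x) x = \<phi> x *\<^sub>R grad \<eta> x + \<eta> x *\<^sub>R grad \<phi> x"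
proof -
  obtain K where K: "compact K" "K \<subseteq> \<Omega>" "\<And>x. x \<notin> K \<Longrightarrow> \<eta> x = 0" "\<And>x. x \<notin> K \<Longrightarrow> grad \<eta> x = 0"
    by (rule Cc1_compact_support[OF assms(2)], rule that)
  show "(\<lambda>x. \<phi> x * \<eta> x) \<in> Cc1 \<Omega>"
    using C_diff_mult[OF assms(1)] assms(2) compactly_containedI[OF K(1,2), of "\<lambda>x. \<phi> x * \<eta> x"] K(3)
    by (simp add: Cc1_def del: C_diff.simps)
  have "GDERIV \<phi> x :> grad \<phi> x" "GDERIV \<eta> x :> grad \<eta> x"
    using assms Cc1_gderiv C_diff_1_iff by blast+
  then show "grad (\<lambda>x. \<phi> x * \<eta> x) x = \<phi> x *\<^sub>R grad \<eta> x + \<eta> x *\<^sub>R grad \<phi> x"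
    by (intro grad_eqI GDERIV_mult)
qed

text \<open>Compact support of \<eta> alone makes the product compactly supported, so the gradient
  of the product integrates to 0.\<close>

lemma integration_by_parts:
  fixes \<phi> \<eta> :: "'a::euclidean_space \<Rightarrow> real"
  assumes \<Omega>: "open \<Omega>" and \<phi>: "C_diff 1 \<phi>" and \<eta>: "\<eta> \<in> Cc1 \<Omega>"
  shows "(LINT x|lebesgue_on \<Omega>. \<phi> x * (grad \<eta> x \<bullet> b)) = - (LINT x|lebesgue_on \<Omega>. (grad \<phi> x \<bullet> b) * \<eta> x)"
proof -
  obtain K where K: "compact K" "K \<subseteq> \<Omega>" "\<And>x. x \<notin> K \<Longrightarrow> \<eta> x = 0" "\<And>x. x \<notin> K \<Longrightarrow> grad \<eta> x = 0"
    by (rule Cc1_compact_support[OF \<eta>], rule that)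
  have c: "continuous_on UNIV \<phi>" "continuous_on UNIV (grad \<phi>)"
    using \<phi> C_diff_lower[of 0 \<phi>] C_diff_1_iff by auto
  note c = c Cc1_gderiv(2,3)[OF \<eta>]
  note * = continuous_compact_support_integral[OF _ K(1,2) _ \<Omega>]
  have 1: "integrable (lebesgue_on \<Omega>) (\<lambda>x. \<phi> x * (grad \<eta> x \<bullet> b))"
    and 2: "integrable (lebesgue_on \<Omega>) (\<lambda>x. (grad \<phi> x \<bullet> b) * \<eta> x)"
    using K c by (auto intro!: *(2) continuous_intros)
  have g: "grad (\<lambda>x. \<phi> x * \<eta> x) x \<bullet> b = \<phi> x * (grad \<eta> x \<bullet> b) + (grad \<phi> x \<bullet> b) * \<eta> x" for x
    unfolding Cc1_mult(2)[OF \<phi> \<eta>] by (simp add: inner_add_left mult.commute)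
  have "(LINT x|lborel. \<phi> x * (grad \<eta> x \<bullet> b) + (grad \<phi> x \<bullet> b) * \<eta> x) = 0"
    using integral_grad_eq_0[OF Cc1_mult(1)[OF \<phi> \<eta>], of b] unfolding g .
  then have "(LINT x|lebesgue_on \<Omega>. \<phi> x * (grad \<eta> x \<bullet> b) + (grad \<phi> x \<bullet> b) * \<eta> x) = 0"
    using K c by (subst *(3)) (auto intro!: continuous_intros)
  then show ?thesis using 1 2 by simp
qed

text \<open>Integration by parts against the linear function x . b, whose derivative along b is 1.
  In the final argument it acts as a Poincare inequality: it recovers a function from its
  gradient.\<close>

lemma integral_Cc1:
  fixes \<psi> :: "'a::euclidean_space \<Rightarrow> real"
  assumes "open \<Omega>" "\<psi> \<in> Cc1 \<Omega>" "norm b = 1"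
  shows "(LINT x|lebesgue_on \<Omega>. \<psi> x) = - (LINT x|lebesgue_on \<Omega>. (x \<bullet> b) * (grad \<psi> x \<bullet> b))"
proof -
  have "GDERIV (\<lambda>x. x \<bullet> b) x :> b" for x
    unfolding gderiv_def by (auto intro!: derivative_eq_intros)
  then have *: "C_diff 1 (\<lambda>x. x \<bullet> b)" "grad (\<lambda>x. x \<bullet> b) = (\<lambda>x. b)"
    using C_diff_1I[of "\<lambda>x. x \<bullet> b" "\<lambda>x. b"] by auto
  have "b \<bullet> b = 1" using assms(3) by (simp add: dot_square_norm)
  then show ?thesis using integration_by_parts[OF assms(1) *(1) assms(2), of b] *(2) by simp
qed

section \<open>Smooth bumps on boxes\<close>

lemma step_tendsto: "(\<lambda>n. step (real (Suc n) * s)) \<longlonglongrightarrow> (if 0 < s then 1 else 0)"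
proof (cases "0 < s")
  case True
  have "(\<lambda>n. exp (- (inverse (real (Suc n)) * inverse s))) \<longlonglongrightarrow> exp (- (0 * inverse s))"
    by (intro tendsto_intros LIMSEQ_inverse_real_of_nat)
  moreover have "step (real (Suc n) * s) = exp (- (inverse (real (Suc n)) * inverse s))" for n
    using True by (simp add: step_def flat_def divide_inverse zero_less_mult_iff)
  ultimately show ?thesis using True by simp
next
  case False
  then have "real (Suc n) * s \<le> 0" for n by (simp add: mult_nonneg_nonpos)
  then have "(\<lambda>n. step (real (Suc n) * s)) = (\<lambda>n. 0)" by (simp add: step_nonpos)
  then show ?thesis using False by simp
qed

text \<open>Each bump is a product of two steps per coordinate, one for each face. All vanish off
  the closed box, and steepening them yields the indicator of the open box.\<close>

lemma ex_bumps_tendsto_indicator_box: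
  fixes a b :: "'a::euclidean_space"
  assumes "cbox a b \<subseteq> \<Omega>"
  obtains \<phi> where "\<And>n. \<phi> n \<in> Cc_infty \<Omega>" "\<And>n x. 0 \<le> \<phi> n x" "\<And>n x. \<phi> n x \<le> 1"
    "\<And>n x. x \<notin> cbox a b \<Longrightarrow> \<phi> n x = 0" "\<And>x. (\<lambda>n. \<phi> n x) \<longlonglongrightarrow> indicator (box a b) x"
proof
  define \<phi> where "\<phi> n x = (\<Prod>i\<in>Basis. step (real (Suc n) * (x \<bullet> i - a \<bullet> i)) * step (real (Suc n) * (b \<bullet> i - x \<bullet> i)))"
    for n :: nat and x :: 'a
  show 0: "\<phi> n x = 0" if x: "x \<notin> cbox a b" for n x
  proof -
    obtain i where i: "i \<in> Basis" "x \<bullet> i - a \<bullet> i \<le> 0 \<or> b \<bullet> i - x \<bullet> i \<le> 0"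
      using x by (force simp: mem_box)
    then have "step (real (Suc n) * (x \<bullet> i - a \<bullet> i)) * step (real (Suc n) * (b \<bullet> i - x \<bullet> i)) = 0"
      by (auto simp: step_nonpos mult_nonneg_nonpos)
    then show ?thesis unfolding \<phi>_def using i(1) by (intro prod_zero) auto
  qed
  have "smooth (\<phi> n)" for n
  proof -
    have "smooth (\<lambda>x::'a. step (real (Suc n) * (x \<bullet> i - a \<bullet> i)))"
      "smooth (\<lambda>x::'a. step (real (Suc n) * (b \<bullet> i - x \<bullet> i)))" for i
      using smooth_flat_affine[of 1 "- (real (Suc n) * (a \<bullet> i))" "real (Suc n) *\<^sub>R i"]
        smooth_flat_affine[of 1 "real (Suc n) * (b \<bullet> i)" "- real (Suc n) *\<^sub>R i"]
      by (simp_all add: step_def algebra_simps)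
    then show ?thesis unfolding \<phi>_def by (intro smooth_prod smooth_mult)
  qed
  then show "\<phi> n \<in> Cc_infty \<Omega>" for n
    using compactly_containedI[OF compact_cbox assms 0] by (auto simp: Cc_infty_def)
  show "0 \<le> \<phi> n x" "\<phi> n x \<le> 1" for n x
    unfolding \<phi>_def by (auto intro!: prod_nonneg prod_le_1 mult_le_one step_bounds mult_nonneg_nonneg)
  show "(\<lambda>n. \<phi> n x) \<longlonglongrightarrow> indicator (box a b) x" for x
  proof -
    have "(\<lambda>n. \<phi> n x) \<longlonglongrightarrow> (\<Prod>i\<in>(Basis::'a set). (if 0 < x \<bullet> i - a \<bullet> i then 1 else 0) * (if 0 < b \<bullet> i - x \<bullet> i then 1 else 0))"
      unfolding \<phi>_def by (intro tendsto_prod tendsto_mult step_tendsto)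
    also have "(\<Prod>i\<in>(Basis::'a set). (if 0 < x \<bullet> i - a \<bullet> i then 1 else 0) * (if 0 < b \<bullet> i - x \<bullet> i then 1 else (0::real)))
        = indicator (box a b) x"
    proof (cases "x \<in> box a b")
      case False
      then obtain i where "i \<in> Basis" "\<not> (0 < x \<bullet> i - a \<bullet> i \<and> 0 < b \<bullet> i - x \<bullet> i)"
        by (auto simp: mem_box)
      then show ?thesis using False by (auto intro!: prod_zero bexI[of _ i])
    qed (auto simp: mem_box intro!: prod.neutral)
    finally show ?thesis .
  qed
qed

subsection \<open>The fundamental lemma of the calculus of variations\<close>

text \<open>Dynkin's argument: boxes form an intersection-stable generator of the Borel sets, and
  the sets over which \<open>G\<close> integrates to 0 are closed under disjoint countable unions
  and, as the total integral is 0, under complements.\<close>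

lemma AE_eq_0_if_integral_box_eq_0:
  fixes G :: "'a::euclidean_space \<Rightarrow> real"
  assumes G: "integrable lborel G" and 0: "integral\<^sup>L lborel G = 0"
    and box: "\<And>a b. (LINT x|lborel. indicator (box a b) x * G x) = 0"
  shows "AE x in lborel. G x = 0"
proof (rule sigma_finite_measure.density_zero[OF sigma_finite_lborel G])
  fix A :: "'a set" assume "A \<in> sets lborel"
  then have A: "A \<in> sigma_sets UNIV (range (\<lambda>(a, b). box a b))"
    by (simp add: borel_eq_box)
  have stable: "Int_stable (range (\<lambda>(a, b). box a b :: 'a set))"
  proof (rule Int_stableI)
    fix X Y :: "'a set"
    assume "X \<in> range (\<lambda>(a, b). box a b)" "Y \<in> range (\<lambda>(a, b). box a b)"
    then obtain a b c d where "X = box a b" "Y = box c d" by auto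
    then show "X \<inter> Y \<in> range (\<lambda>(a, b). box a b)" by (auto simp: box_Int_box intro: range_eqI[where x="(_, _)"])
  qed
  have sub: "range (\<lambda>(a, b). box a b) \<subseteq> Pow (UNIV :: 'a set)" by simp
  from A show "set_lebesgue_integral lborel A G = 0"
  proof (induction rule: sigma_sets_induct_disjoint[OF stable sub, consumes 1, case_names basic empty compl union])
    case (basic A)
    then show ?case using box by (auto simp: set_lebesgue_integral_def)
  next
    case empty
    then show ?case by (simp add: set_lebesgue_integral_def)
  next
    case (compl A)
    have "A \<in> sets lborel" using compl(1) by (simp add: borel_eq_box)
    then have i: "integrable lborel (\<lambda>x. indicator A x *\<^sub>R G x)"
      using G by (rule integrable_mult_indicator)
    have "set_lebesgue_integral lborel (UNIV - A) G = (LINT x|lborel. G x - indicator A x *\<^sub>R G x)"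
      unfolding set_lebesgue_integral_def
      by (rule Bochner_Integration.integral_cong) (auto simp: indicator_def)
    also have "\<dots> = 0"
      using compl(2) 0 G i by (simp add: set_lebesgue_integral_def)
    finally show ?case .
  next
    case (union A)
    have A: "A i \<in> sets lborel" for i
      using subsetD[OF union(2) rangeI[of A i]] by (simp add: borel_eq_box)
    then have "(\<Union>i. A i) \<in> sets lborel" by (intro sets.countable_UN) auto
    then have int: "set_integrable lborel (\<Union>i. A i) G"
      unfolding set_integrable_def using G by (rule integrable_mult_indicator)
    have disj: "A i \<inter> A j = {}" if "i \<noteq> j" for i j
      using union(1) that unfolding disjoint_family_on_def by blast
    have "set_lebesgue_integral lborel (\<Union>i. A i) G = (\<Sum>i. set_lebesgue_integral lborel (A i) G)"
      by (rule lebesgue_integral_countable_add[OF A disj int])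
    also have "\<dots> = 0" by (simp add: union(3))
    finally show ?case .
  qed
qed

text \<open>Testing with the bumps and dominated convergence give integral 0 over every box whose
  closed box lies in \<Omega>. Hence \<open>g\<close> vanishes almost everywhere in each such box,
  and countably many of them cover \<Omega>.\<close>

lemma fundamental_lemma:
  fixes g :: "'a::euclidean_space \<Rightarrow> real"
  assumes \<Omega>: "open \<Omega>" and g: "g locally_integrable_on \<Omega>"
    and 0: "\<And>\<phi>. \<phi> \<in> Cc_infty \<Omega> \<Longrightarrow> (LINT x|lebesgue_on \<Omega>. g x * \<phi> x) = 0"
  shows "AE x in lebesgue_on \<Omega>. g x = 0"
proof -
  have \<Omega>m: "\<Omega> \<inter> space lebesgue \<in> sets lebesgue" using \<Omega> by auto
  have gi: "integrable lebesgue (\<lambda>x. indicator (cbox a b) x * g x)" if "cbox a b \<subseteq> \<Omega>" for a b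
    using g that by (auto simp: locally_integrable_on_def set_integrable_def)
  have box: "(LINT x|lebesgue. indicator (box a b) x * g x) = 0" if ab: "cbox a b \<subseteq> \<Omega>" for a b
  proof -
    obtain \<phi> where \<phi>: "\<And>n. \<phi> n \<in> Cc_infty \<Omega>" "\<And>n x. 0 \<le> \<phi> n x" "\<And>n x. \<phi> n x \<le> 1"
      "\<And>n x. x \<notin> cbox a b \<Longrightarrow> \<phi> n x = 0" "\<And>x. (\<lambda>n. \<phi> n x) \<longlonglongrightarrow> indicator (box a b) x"
      by (rule ex_bumps_tendsto_indicator_box[OF ab], rule that)
    have gm: "(\<lambda>x. indicator (cbox a b) x * g x) \<in> borel_measurable lebesgue"
      using gi[OF ab] by auto
    have "(\<lambda>n. LINT x|lebesgue. (indicator (cbox a b) x * g x) * \<phi> n x) \<longlonglongrightarrow>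
        (LINT x|lebesgue. (indicator (cbox a b) x * g x) * indicator (box a b) x)"
    proof (rule integral_dominated_convergence)
      show "(\<lambda>x. (indicator (cbox a b) x * g x) * indicator (box a b) x) \<in> borel_measurable lebesgue"
        by (intro borel_measurable_times gm borel_measurable_indicator) auto
      have "\<phi> n \<in> borel_measurable lebesgue" for n
        using Cc1_gderiv(3)[of "\<phi> n" \<Omega> UNIV] \<phi>(1) Cc_infty_subset_Cc1
        by (intro measurable_completion) (auto intro: borel_measurable_continuous_onI)
      then show "(\<lambda>x. (indicator (cbox a b) x * g x) * \<phi> n x) \<in> borel_measurable lebesgue" for n
        by (intro borel_measurable_times gm)
      show "integrable lebesgue (\<lambda>x. norm (indicator (cbox a b) x * g x))"
        using gi[OF ab] by (rule integrable_norm)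
      show "AE x in lebesgue. (\<lambda>n. (indicator (cbox a b) x * g x) * \<phi> n x)
          \<longlonglongrightarrow> (indicator (cbox a b) x * g x) * indicator (box a b) x"
        by (intro AE_I2 tendsto_mult tendsto_const \<phi>(5))
      show "AE x in lebesgue. norm ((indicator (cbox a b) x * g x) * \<phi> n x)
          \<le> norm (indicator (cbox a b) x * g x)" for n
        by (intro AE_I2) (simp add: abs_mult \<phi>(2,3) mult_left_le)
    qed
    moreover have "(LINT x|lebesgue. (indicator (cbox a b) x * g x) * \<phi> n x) = 0" for n
    proof -
      have "(LINT x|lebesgue_on \<Omega>. g x * \<phi> n x) = (LINT x|lebesgue. indicator \<Omega> x *\<^sub>R (g x * \<phi> n x))"
        by (rule integral_restrict_space[OF \<Omega>m])
      also have "\<dots> = (LINT x|lebesgue. (indicator (cbox a b) x * g x) * \<phi> n x)"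
      proof (rule Bochner_Integration.integral_cong[OF refl])
        show "indicator \<Omega> x *\<^sub>R (g x * \<phi> n x) = (indicator (cbox a b) x * g x) * \<phi> n x" for x
          using ab \<phi>(4)[of x n] by (cases "x \<in> cbox a b") (auto simp: indicator_def)
      qed
      finally show ?thesis using 0[OF \<phi>(1)] by simp
    qed
    ultimately have "(LINT x|lebesgue. (indicator (cbox a b) x * g x) * indicator (box a b) x) = 0"
      by (simp add: LIMSEQ_const_iff)
    moreover have "(indicator (cbox a b) x * g x) * indicator (box a b) x = indicator (box a b) x * g x" for x
      using box_subset_cbox[of a b] by (auto simp: indicator_def)
    ultimately show ?thesis by simp
  qed
  have null: "AE x in lebesgue. x \<in> cbox a b \<longrightarrow> g x = 0" if ab: "cbox a b \<subseteq> \<Omega>" for a b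
  proof -
    let ?G = "\<lambda>x. indicator (box a b) x * g x"
    have "?G = (\<lambda>x. indicator (box a b) x *\<^sub>R (indicator (cbox a b) x * g x))"
      using box_subset_cbox[of a b] by (auto simp: indicator_def fun_eq_iff)
    then have Gi: "integrable lebesgue ?G"
      using integrable_mult_indicator[OF _ gi[OF ab], of "box a b"] by simp
    \<comment> \<open>The argument on boxes needs a Borel function, whereas \<open>g\<close> is only
      Lebesgue measurable.\<close>
    obtain G where G: "G \<in> borel_measurable lborel" "AE x in lborel. ?G x = G x"
      using completion_ex_borel_measurable_real[of ?G lborel] Gi by auto
    have G': "AE x in lebesgue. ?G x = G x" using G(2) by (rule AE_completion)
    have GL: "G \<in> borel_measurable lebesgue" using G(1) by (rule measurable_completion)
    have "integrable lebesgue G"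
      using integrable_cong_AE_imp[OF Gi GL G'] .
    then have Gl: "integrable lborel G" using G(1) by (simp add: integrable_completion)
    have B: "(LINT x|lborel. indicator (box c d) x * G x) = 0" for c d
    proof -
      have "(LINT x|lborel. indicator (box c d) x * G x) = (LINT x|lebesgue. indicator (box c d) x * G x)"
        using G(1) by (intro integral_completion[symmetric] borel_measurable_times borel_measurable_indicator) auto
      also have "\<dots> = (LINT x|lebesgue. indicator (box c d) x * ?G x)"
      proof (rule integral_cong_AE)
        show "(\<lambda>x. indicator (box c d) x * G x) \<in> borel_measurable lebesgue"
          by (rule borel_measurable_times[OF borel_measurable_indicator GL]) simp
        show "(\<lambda>x. indicator (box c d) x * ?G x) \<in> borel_measurable lebesgue"
          by (rule borel_measurable_times[OF borel_measurable_indicator borel_measurable_integrable[OF Gi]]) simp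
        show "AE x in lebesgue. indicator (box c d) x * G x = indicator (box c d) x * ?G x"
          using G' by eventually_elim simp
      qed
      also have "\<dots> = (LINT x|lebesgue. indicator (box c d \<inter> box a b) x * g x)"
        by (intro Bochner_Integration.integral_cong) (auto simp: indicator_def)
      also have "\<dots> = 0"
      proof (cases "box c d \<inter> box a b = {}")
        case False
        \<comment> \<open>These are the corners of the intersection. As it is nonempty, its closed
          box is its closure and so remains inside \<open>cbox a b\<close>.\<close>
        define a' where "a' = (\<Sum>i\<in>Basis. max (c \<bullet> i) (a \<bullet> i) *\<^sub>R i)"
        define b' where "b' = (\<Sum>i\<in>Basis. min (d \<bullet> i) (b \<bullet> i) *\<^sub>R i)"
        have e: "box c d \<inter> box a b = box a' b'" by (simp add: box_Int_box a'_def b'_def)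
        then have "box a' b' \<noteq> {}" using False by simp
        then have "cbox a' b' = closure (box a' b')" by (rule closure_box[symmetric])
        also have "\<dots> \<subseteq> cbox a b"
          by (rule closure_minimal) (use e box_subset_cbox[of a b] in auto)
        finally show ?thesis using box[of a' b'] e ab by simp
      qed simp
      finally show ?thesis .
    qed
    have "integral\<^sup>L lborel G = 0"
    proof -
      have "integral\<^sup>L lborel G = (LINT x|lborel. indicator (box a b) x * G x)"
        using G by (intro integral_cong_AE borel_measurable_times borel_measurable_indicator)
          (auto simp: indicator_def elim!: eventually_mono)
      then show ?thesis using B by simp
    qed
    then have "AE x in lborel. G x = 0"
      using AE_eq_0_if_integral_box_eq_0[OF Gl _ B] by simp
    then have "AE x in lebesgue. G x = 0" by (rule AE_completion)
    \<comment> \<open>\<open>G\<close> only sees the open box; the faces form a null set.\<close>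
    moreover have "AE x in lebesgue. x \<notin> cbox a b - box a b"
      using negligible_frontier_interval[of a b]
      unfolding negligible_iff_null_sets by (rule AE_not_in)
    ultimately show ?thesis
      using G' by eventually_elim (auto simp: indicator_def split: if_splits)
  qed
  obtain \<D> where \<D>: "countable \<D>" "\<D> \<subseteq> Pow \<Omega>"
     "\<And>X. X \<in> \<D> \<Longrightarrow> \<exists>a b. X = cbox a b" "\<Union>\<D> = \<Omega>"
    by (rule open_countable_Union_open_cbox[OF \<Omega>], rule that)
  have "AE x in lebesgue. x \<in> X \<longrightarrow> g x = 0" if X: "X \<in> \<D>" for X
  proof -
    obtain a b where "X = cbox a b" using \<D>(3)[OF X] by auto
    then show ?thesis using null[of a b] X \<D>(2) by blast
  qed
  then have "AE x in lebesgue. \<forall>X\<in>\<D>. x \<in> X \<longrightarrow> g x = 0"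
    unfolding AE_ball_countable[OF \<D>(1)] by (intro ballI)
  then have "AE x in lebesgue. x \<in> \<Omega> \<longrightarrow> g x = 0"
    by eventually_elim (use \<D>(4) in auto)
  then show ?thesis by (simp add: AE_restrict_space_iff[OF \<Omega>m])
qed

subsection \<open>Weak gradients\<close>

lemma locally_integrable_on_inner:
  fixes g :: "'a::euclidean_space \<Rightarrow> 'b::euclidean_space"
  assumes "g locally_integrable_on \<Omega>"
  shows "(\<lambda>x. g x \<bullet> b) locally_integrable_on \<Omega>"
  unfolding locally_integrable_on_def set_integrable_def
proof (intro allI impI)
  fix K assume "compact K \<and> K \<subseteq> \<Omega>"
  then have "integrable lebesgue (\<lambda>x. indicator K x *\<^sub>R g x)"
    using assms unfolding locally_integrable_on_def set_integrable_def by blast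
  then have "integrable lebesgue (\<lambda>x. (indicator K x *\<^sub>R g x) \<bullet> b)"
    by (rule integrable_inner_left)
  then show "integrable lebesgue (\<lambda>x. indicator K x *\<^sub>R (g x \<bullet> b))" by simp
qed

lemma locally_integrable_on_diff:
  fixes f g :: "'a::euclidean_space \<Rightarrow> 'b::euclidean_space"
  shows "f locally_integrable_on \<Omega> \<Longrightarrow> g locally_integrable_on \<Omega> \<Longrightarrow>
    (\<lambda>x. f x - g x) locally_integrable_on \<Omega>"
  unfolding locally_integrable_on_def by (auto intro: set_integral_diff(1))

lemma has_weak_gradientD:
  assumes "has_weak_gradient \<Omega> u g"
  shows "u locally_integrable_on \<Omega>" "g locally_integrable_on \<Omega>"
    "\<And>\<phi> b. \<phi> \<in> Cc_infty \<Omega> \<Longrightarrow> b \<in> Basis \<Longrightarrow>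
      (LINT x|lebesgue_on \<Omega>. u x * (grad \<phi> x \<bullet> b)) = - (LINT x|lebesgue_on \<Omega>. (g x \<bullet> b) * \<phi> x)"
  using assms unfolding has_weak_gradient_def by blast+

text \<open>Existence of both integrals in the defining identity is what linearity of the integral
  requires below.\<close>

lemma weak_gradient_integrable:
  assumes "has_weak_gradient \<Omega> u g" "open \<Omega>" "\<phi> \<in> Cc1 \<Omega>"
  shows "integrable (lebesgue_on \<Omega>) (\<lambda>x. u x * (grad \<phi> x \<bullet> b))"
    "integrable (lebesgue_on \<Omega>) (\<lambda>x. (g x \<bullet> b) * \<phi> x)"
proof -
  obtain K where K: "compact K" "K \<subseteq> \<Omega>" "\<And>x. x \<notin> K \<Longrightarrow> \<phi> x = 0" "\<And>x. x \<notin> K \<Longrightarrow> grad \<phi> x = 0"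
    by (rule Cc1_compact_support[OF assms(3)], rule that)
  note c = Cc1_gderiv(2,3)[OF assms(3)]
  have u: "u locally_integrable_on \<Omega>" and g: "(\<lambda>x. g x \<bullet> b) locally_integrable_on \<Omega>"
    using has_weak_gradientD(1,2)[OF assms(1)] by (simp_all add: locally_integrable_on_inner)
  show "integrable (lebesgue_on \<Omega>) (\<lambda>x. u x * (grad \<phi> x \<bullet> b))"
    using K(4) by (intro locally_integrable_times_continuous[OF u _ K(1,2) _ assms(2)] continuous_intros c)
      simp
  show "integrable (lebesgue_on \<Omega>) (\<lambda>x. (g x \<bullet> b) * \<phi> x)"
    by (rule locally_integrable_times_continuous[OF g c(2) K(1,2,3) assms(2)])
qed

lemma has_weak_gradient_diff:
  assumes "has_weak_gradient \<Omega> u g" "has_weak_gradient \<Omega> v h" "open \<Omega>"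
  shows "has_weak_gradient \<Omega> (\<lambda>x. u x - v x) (\<lambda>x. g x - h x)"
  unfolding has_weak_gradient_def
proof (intro conjI ballI)
  show "(\<lambda>x. u x - v x) locally_integrable_on \<Omega>" "(\<lambda>x. g x - h x) locally_integrable_on \<Omega>"
    by (intro locally_integrable_on_diff has_weak_gradientD(1,2)[OF assms(1)] has_weak_gradientD(1,2)[OF assms(2)])+
  fix \<phi> b assume *: "\<phi> \<in> Cc_infty \<Omega>" "b \<in> (Basis::'a set)"
  then have "\<phi> \<in> Cc1 \<Omega>" using Cc_infty_subset_Cc1 by blast
  note i = weak_gradient_integrable[OF assms(1,3) this, of b] weak_gradient_integrable[OF assms(2,3) this, of b]
  show "(LINT x|lebesgue_on \<Omega>. (u x - v x) * (grad \<phi> x \<bullet> b)) = - (LINT x|lebesgue_on \<Omega>. ((g x - h x) \<bullet> b) * \<phi> x)"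
    using has_weak_gradientD(3)[OF assms(1) *] has_weak_gradientD(3)[OF assms(2) *] i
    by (simp add: left_diff_distrib inner_diff_left)
qed

lemma continuous_locally_integrable_on:
  fixes f :: "'a::euclidean_space \<Rightarrow> 'b::euclidean_space"
  assumes "continuous_on UNIV f"
  shows "f locally_integrable_on \<Omega>"
  unfolding locally_integrable_on_def set_integrable_def
proof (intro allI impI)
  fix K assume "compact K \<and> K \<subseteq> \<Omega>"
  then have "integrable lborel (\<lambda>x. indicator K x *\<^sub>R f x)"
    using assms by (intro borel_integrable_compact) (auto intro: continuous_on_subset)
  then show "integrable lebesgue (\<lambda>x. indicator K x *\<^sub>R f x)"
    by (simp add: integrable_completion)
qed

lemma has_weak_gradient_C1:
  fixes \<phi> :: "'a::euclidean_space \<Rightarrow> real"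
  assumes \<phi>: "C_diff 1 \<phi>" and "open \<Omega>"
  shows "has_weak_gradient \<Omega> \<phi> (grad \<phi>)"
proof -
  have c: "continuous_on UNIV \<phi>" "continuous_on UNIV (grad \<phi>)"
    using \<phi> C_diff_lower[of 0 \<phi>] C_diff_1_iff by auto
  then have "\<phi> locally_integrable_on \<Omega>" "grad \<phi> locally_integrable_on \<Omega>"
    by (simp_all add: continuous_locally_integrable_on)
  moreover have "(LINT x|lebesgue_on \<Omega>. \<phi> x * (grad \<eta> x \<bullet> b)) = - (LINT x|lebesgue_on \<Omega>. (grad \<phi> x \<bullet> b) * \<eta> x)"
    if "\<eta> \<in> Cc_infty \<Omega>" for \<eta> b
    by (rule integration_by_parts[OF assms(2) \<phi> subsetD[OF Cc_infty_subset_Cc1 that]])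
  ultimately show ?thesis unfolding has_weak_gradient_def by simp
qed

text \<open>The difference of two weak gradients is a weak gradient of u - u = 0, and the
  fundamental lemma kills each of its coordinates.\<close>

lemma weak_gradient_unique:
  fixes g h :: "'a::euclidean_space \<Rightarrow> 'a"
  assumes "has_weak_gradient \<Omega> u g" "has_weak_gradient \<Omega> u h" "open \<Omega>"
  shows "AE x in lebesgue_on \<Omega>. g x = h x"
proof -
  have "AE x in lebesgue_on \<Omega>. (g x - h x) \<bullet> b = 0" if b: "b \<in> Basis" for b
  proof (rule fundamental_lemma[OF assms(3)])
    show "(\<lambda>x. (g x - h x) \<bullet> b) locally_integrable_on \<Omega>"
      by (intro locally_integrable_on_inner locally_integrable_on_diff has_weak_gradientD(2)[OF assms(1)]
        has_weak_gradientD(2)[OF assms(2)])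
    fix \<phi> assume "\<phi> \<in> Cc_infty \<Omega>"
    then have "(LINT x|lebesgue_on \<Omega>. (u x - u x) * (grad \<phi> x \<bullet> b)) =
        - (LINT x|lebesgue_on \<Omega>. ((g x - h x) \<bullet> b) * \<phi> x)"
      using b by (rule has_weak_gradientD(3)[OF has_weak_gradient_diff[OF assms]])
    then show "(LINT x|lebesgue_on \<Omega>. ((g x - h x) \<bullet> b) * \<phi> x) = 0" by simp
  qed
  then have "AE x in lebesgue_on \<Omega>. \<forall>b\<in>Basis. (g x - h x) \<bullet> b = 0"
    unfolding AE_ball_countable[OF countable_finite[OF finite_Basis]] by (intro ballI)
  then show ?thesis
  proof eventually_elim
    case (elim x)
    have "g x - h x = 0" by (rule euclidean_eqI) (use elim in simp)
    then show ?case by simp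
  qed
qed

text \<open>\<open>weak_grad\<close> is an arbitrary choice, so uniqueness is the only access to its
  values.\<close>

lemma weak_grad_AE:
  assumes "has_weak_gradient \<Omega> u g" "open \<Omega>"
  shows "AE x in lebesgue_on \<Omega>. weak_grad \<Omega> u x = g x"
proof -
  have "has_weak_gradient \<Omega> u (weak_grad \<Omega> u)"
    unfolding weak_grad_def by (rule someI[of "has_weak_gradient \<Omega> u", OF assms(1)])
  then show ?thesis using assms by (rule weak_gradient_unique)
qed

subsection \<open>Weighted integrals\<close>

text \<open>Split q_n a_n = (q_n - q') a_n + q' a_n. The first part is at most C times the L^1
  distance, and the second converges by dominated convergence. In the applications the bounded
  factors are built from \<open>step\<close> and \<open>dstep\<close>.\<close>

lemma integral_mult_bounded_tendsto:
  fixes q :: "nat \<Rightarrow> 'a \<Rightarrow> real"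
  assumes q: "\<And>n. integrable M (q n)" "integrable M q'" "(\<lambda>n. LINT x|M. \<bar>q n x - q' x\<bar>) \<longlonglongrightarrow> 0"
    and a: "\<And>n. a n \<in> borel_measurable M" "a' \<in> borel_measurable M"
      "\<And>n x. x \<in> space M \<Longrightarrow> \<bar>a n x\<bar> \<le> C" "AE x in M. (\<lambda>n. a n x) \<longlonglongrightarrow> a' x"
  shows "integrable M (\<lambda>x. q n x * a n x)" "integrable M (\<lambda>x. q' x * a' x)"
    "(\<lambda>n. LINT x|M. q n x * a n x) \<longlonglongrightarrow> (LINT x|M. q' x * a' x)"
proof -
  have bdd: "\<bar>r x * a n x\<bar> \<le> C * \<bar>r x\<bar>" if "x \<in> space M" for r x n
    using mult_right_mono[OF a(3)[OF that, of n], of "\<bar>r x\<bar>"] by (simp add: abs_mult mult.commute)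
  have i: "integrable M (\<lambda>x. r x * a n x)" if r: "integrable M r" for r n
  proof (rule Bochner_Integration.integrable_bound)
    show "integrable M (\<lambda>x. C * \<bar>r x\<bar>)" using r by simp
    show "(\<lambda>x. r x * a n x) \<in> borel_measurable M" using r a(1) by simp
    show "AE x in M. norm (r x * a n x) \<le> norm (C * \<bar>r x\<bar>)"
      using bdd by (intro AE_I2) (force intro: order_trans[OF _ abs_ge_self])
  qed
  show 1: "integrable M (\<lambda>x. q n x * a n x)" for n by (rule i[OF q(1)])
  have dom: "integrable M (\<lambda>x. C * \<bar>q' x\<bar>)" using q(2) by simp
  have lim: "AE x in M. (\<lambda>n. q' x * a n x) \<longlonglongrightarrow> q' x * a' x"
    using a(4) by eventually_elim (rule tendsto_mult_left)
  have bound: "AE x in M. norm (q' x * a n x) \<le> C * \<bar>q' x\<bar>" for n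
    using bdd by (intro AE_I2) auto
  have m: "(\<lambda>x. q' x * a' x) \<in> borel_measurable M" "(\<lambda>x. q' x * a n x) \<in> borel_measurable M" for n
    using q(2) a(1,2) by simp_all
  show "integrable M (\<lambda>x. q' x * a' x)"
    by (rule integrable_dominated_convergence[OF m dom lim bound])
  have A: "(\<lambda>n. LINT x|M. q' x * a n x) \<longlonglongrightarrow> (LINT x|M. q' x * a' x)"
    by (rule integral_dominated_convergence[OF m dom lim bound])
  have d: "integrable M (\<lambda>x. q n x - q' x)" for n using q by simp
  have "(\<lambda>n. LINT x|M. (q n x - q' x) * a n x) \<longlonglongrightarrow> 0"
  proof (rule Lim_null_comparison)
    show "\<forall>\<^sub>F n in sequentially. norm (LINT x|M. (q n x - q' x) * a n x) \<le> C * (LINT x|M. \<bar>q n x - q' x\<bar>)"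
    proof (rule always_eventually, rule allI)
      fix n
      have "norm (LINT x|M. (q n x - q' x) * a n x) \<le> (LINT x|M. norm ((q n x - q' x) * a n x))"
        by (rule integral_norm_bound)
      also have "\<dots> \<le> (LINT x|M. C * \<bar>q n x - q' x\<bar>)"
        using i[OF d] d bdd[of _ "\<lambda>x. q n x - q' x"] by (intro integral_mono) auto
      finally show "norm (LINT x|M. (q n x - q' x) * a n x) \<le> C * (LINT x|M. \<bar>q n x - q' x\<bar>)"
        by simp
    qed
    show "(\<lambda>n. C * (LINT x|M. \<bar>q n x - q' x\<bar>)) \<longlonglongrightarrow> 0"
      using tendsto_mult_left[OF q(3), of C] by simp
  qed
  from tendsto_add[OF this A]
  have "(\<lambda>n. (LINT x|M. (q n x - q' x) * a n x) + (LINT x|M. q' x * a n x)) \<longlonglongrightarrow> (LINT x|M. q' x * a' x)"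
    by simp
  moreover have "(LINT x|M. (q n x - q' x) * a n x) + (LINT x|M. q' x * a n x) = (LINT x|M. q n x * a n x)" for n
    by (subst Bochner_Integration.integral_add[symmetric, OF i[OF d] i[OF q(2)]]) (simp add: algebra_simps)
  ultimately show "(\<lambda>n. LINT x|M. q n x * a n x) \<longlonglongrightarrow> (LINT x|M. q' x * a' x)" by simp
qed

text \<open>A substitute for Hoelder's inequality: with \<open>H\<close> fixed, \<open>\<integral> h\<^sup>p w \<rightarrow> 0\<close> forces
  \<open>\<integral> H\<^sup>p\<^sup>-\<^sup>1 h w \<rightarrow> 0\<close>. The choice \<open>H = w powr (- 1 / (p - 1))\<close>, for which \<open>H\<^sup>p\<^sup>-\<^sup>1 w = 1\<close>, gives convergence
  in the unweighted \<open>L\<^sup>1\<close>.\<close>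

lemma powr_Young:
  fixes H h :: real
  assumes "1 < p" "0 \<le> H" "0 \<le> h" "0 < \<epsilon>"
  shows "H powr (p - 1) * h \<le> \<epsilon> * H powr p + \<epsilon> powr (1 - p) * h powr p"
\<comment> \<open>If h \<le> \<epsilon> H, the first summand alone suffices; otherwise H < h /
  \<epsilon> and the second one does.\<close>
proof (cases "h \<le> \<epsilon> * H")
  case True
  have "H powr (p - 1) * h \<le> H powr (p - 1) * (\<epsilon> * H)"
    using True by (rule mult_left_mono) simp
  also have "\<dots> = \<epsilon> * H powr p"
    using assms by (cases "H = 0") (auto simp: powr_diff)
  finally show ?thesis by (simp add: add_increasing2)
next
  case False
  then have H: "H \<le> h / \<epsilon>" "0 < h" using assms by (auto simp: field_simps intro: le_less_trans[of 0 "\<epsilon> * H"])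
  have "H powr (p - 1) * h \<le> (h / \<epsilon>) powr (p - 1) * h"
    using assms H by (intro mult_right_mono powr_mono2) auto
  also have "\<dots> = \<epsilon> powr (1 - p) * h powr p"
    using assms H by (simp add: powr_divide powr_diff field_simps)
  finally show ?thesis using assms by (simp add: add_increasing)
qed

lemma weighted_product_bound:
  fixes F H h w :: "'a \<Rightarrow> real"
  assumes p: "1 < p" and w: "AE x in M. 0 \<le> w x" and H: "\<And>x. 0 \<le> H x" and h: "\<And>x. 0 \<le> h x"
    and F: "F \<in> borel_measurable M" "AE x in M. \<bar>F x\<bar> \<le> H x powr (p - 1) * h x * w x"
    and I: "integrable M (\<lambda>x. H x powr p * w x)" and J: "integrable M (\<lambda>x. h x powr p * w x)"
  shows "integrable M F"
    "0 < \<epsilon> \<Longrightarrow> (LINT x|M. \<bar>F x\<bar>) \<le>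
      \<epsilon> * (LINT x|M. H x powr p * w x) + \<epsilon> powr (1 - p) * (LINT x|M. h x powr p * w x)"
proof -
  have i: "integrable M (\<lambda>x. \<epsilon> * (H x powr p * w x) + \<epsilon> powr (1 - p) * (h x powr p * w x))" for \<epsilon>
    using I J by simp
  have b: "AE x in M. \<bar>F x\<bar> \<le> \<epsilon> * (H x powr p * w x) + \<epsilon> powr (1 - p) * (h x powr p * w x)" if "0 < \<epsilon>" for \<epsilon>
    using F(2) w
  proof eventually_elim
    case (elim x)
    have "H x powr (p - 1) * h x * w x \<le> (\<epsilon> * H x powr p + \<epsilon> powr (1 - p) * h x powr p) * w x"
      by (rule mult_right_mono[OF powr_Young[OF p H h that] elim(2)])
    then show ?case using elim(1) by (simp add: algebra_simps)
  qed
  show *: "integrable M F"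
  proof (rule Bochner_Integration.integrable_bound[OF i[of 1] F(1)])
    show "AE x in M. norm (F x) \<le> norm (1 * (H x powr p * w x) + 1 powr (1 - p) * (h x powr p * w x))"
      using b[OF zero_less_one] by eventually_elim auto
  qed
  show "(LINT x|M. \<bar>F x\<bar>) \<le>
      \<epsilon> * (LINT x|M. H x powr p * w x) + \<epsilon> powr (1 - p) * (LINT x|M. h x powr p * w x)" if "0 < \<epsilon>"
  proof -
    have "(LINT x|M. \<bar>F x\<bar>) \<le> (LINT x|M. \<epsilon> * (H x powr p * w x) + \<epsilon> powr (1 - p) * (h x powr p * w x))"
      using * i b[OF that] by (intro integral_mono_AE) auto
    then show ?thesis using I J by simp
  qed
qed

text \<open>In the bound with \<epsilon>, first fix \<epsilon> so that the term with
  \<open>H\<close> is small, then let \<open>n\<close> grow to make the other term small.\<close>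

lemma weighted_product_tendsto_0:
  fixes F h :: "nat \<Rightarrow> 'a \<Rightarrow> real"
  assumes p: "1 < p" and w: "AE x in M. 0 \<le> w x" and H: "\<And>x. 0 \<le> H x" and h: "\<And>n x. 0 \<le> h n x"
    and F: "\<And>n. F n \<in> borel_measurable M" "\<And>n. AE x in M. \<bar>F n x\<bar> \<le> H x powr (p - 1) * h n x * w x"
    and I: "integrable M (\<lambda>x. H x powr p * w x)" and J: "\<And>n. integrable M (\<lambda>x. h n x powr p * w x)"
    and lim: "(\<lambda>n. LINT x|M. h n x powr p * w x) \<longlonglongrightarrow> 0"
  shows "(\<lambda>n. LINT x|M. \<bar>F n x\<bar>) \<longlonglongrightarrow> 0"
proof (rule order_tendstoI)
  fix y :: real assume "y < 0"
  then show "\<forall>\<^sub>F n in sequentially. y < (LINT x|M. \<bar>F n x\<bar>)"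
    by (intro always_eventually allI less_le_trans[OF _ integral_nonneg_AE]) auto
next
  fix y :: real assume y: "0 < y"
  define A where "A = (LINT x|M. H x powr p * w x)"
  have "0 \<le> A" unfolding A_def using w by (intro integral_nonneg_AE) (auto elim!: eventually_mono)
  \<comment> \<open>Half of \<open>y\<close> is reserved for the term with \<open>H\<close>; adding
    1 keeps the denominator positive when \<open>A\<close> is 0.\<close>
  define \<epsilon> where "\<epsilon> = y / (2 * (A + 1))"
  have \<epsilon>: "0 < \<epsilon>" "\<epsilon> * A < y / 2 + 0"
    using y \<open>0 \<le> A\<close> by (auto simp: \<epsilon>_def field_simps add_pos_nonneg)
  have "(\<lambda>n. \<epsilon> * A + \<epsilon> powr (1 - p) * (LINT x|M. h n x powr p * w x)) \<longlonglongrightarrow> \<epsilon> * A + \<epsilon> powr (1 - p) * 0"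
    by (intro tendsto_intros lim)
  then have "\<forall>\<^sub>F n in sequentially. \<epsilon> * A + \<epsilon> powr (1 - p) * (LINT x|M. h n x powr p * w x) < y"
    by (rule order_tendstoD) (use \<epsilon> y in auto)
  then show "\<forall>\<^sub>F n in sequentially. (LINT x|M. \<bar>F n x\<bar>) < y"
  proof eventually_elim
    case (elim n)
    have "(LINT x|M. \<bar>F n x\<bar>) \<le> \<epsilon> * A + \<epsilon> powr (1 - p) * (LINT x|M. h n x powr p * w x)"
      unfolding A_def by (rule weighted_product_bound(2)[OF p w H h F I J \<epsilon>(1)])
    then show ?case using elim by simp
  qed
qed

text \<open>Completeness of Lebesgue measure, applied to the extensions by 0.\<close>

lemma borel_measurable_lebesgue_on_AE:
  fixes f g :: "'a::euclidean_space \<Rightarrow> 'b::euclidean_space"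
  assumes S: "S \<in> sets lebesgue" and f: "f \<in> borel_measurable (lebesgue_on S)"
    and ae: "AE x in lebesgue_on S. f x = g x"
  shows "g \<in> borel_measurable (lebesgue_on S)"
proof (rule borel_measurable_if_D)
  have "AE x in lebesgue. x \<in> S \<longrightarrow> f x = g x"
    using ae S by (simp add: AE_restrict_space_iff)
  then have "AE x in lebesgue. (if x \<in> S then f x else 0) = (if x \<in> S then g x else 0)"
    by eventually_elim simp
  with borel_measurable_if_I[OF f S]
  show "(\<lambda>x. if x \<in> S then g x else 0) \<in> borel_measurable lebesgue"
    by (rule borel_measurable_AE)
qed

text \<open>For a simple function in place of \<open>g\<close>, measurability in x for each fixed
  vector suffices, as there are finitely many values. Continuity in the vector carries it to the
  limit.\<close>

lemma Caratheodory_measurable: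
  assumes S: "S \<in> sets lebesgue" and A: "Caratheodory S \<A>" and g: "g \<in> borel_measurable (lebesgue_on S)"
  shows "(\<lambda>x. \<A> x (g x)) \<in> borel_measurable (lebesgue_on S)"
proof -
  let ?M = "lebesgue_on S"
  obtain s where s': "(\<forall>i. simple_function ?M (s i)) \<and> (\<forall>x\<in>space ?M. (\<lambda>i. s i x) \<longlonglongrightarrow> g x) \<and>
      (\<forall>i. \<forall>x\<in>space ?M. dist (s i x) 0 \<le> 2 * dist (g x) 0)"
    using borel_measurable_implies_sequence_metric[OF g, of 0] by (rule exE)
  have s: "simple_function ?M (s i)" "x \<in> S \<Longrightarrow> (\<lambda>i. s i x) \<longlonglongrightarrow> g x" for i x
    using s' by simp_all
  have m: "(\<lambda>x. \<A> x (s i x)) \<in> borel_measurable ?M" for i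
  proof (rule measurable_compose_countable'[where g="s i" and I="s i ` space ?M"])
    show "(\<lambda>x. \<A> x z) \<in> borel_measurable ?M" for z
      using A by (simp add: Caratheodory_def)
    have fin: "finite (s i ` space ?M)" using s(1)[of i] by (simp add: simple_function_def)
    then show "countable (s i ` space ?M)" by (rule countable_finite)
    show "s i \<in> measurable ?M (count_space (s i ` space ?M))"
      using s(1)[of i] by (subst measurable_count_space_eq2[OF fin]) (auto simp: simple_function_def)
  qed
  have "AE x in ?M. continuous_on UNIV (\<A> x)" using A by (simp add: Caratheodory_def)
  \<comment> \<open>Setting everything to 0 on this null set turns almost everywhere convergence
    into convergence at every point.\<close>
  then obtain N where N: "{x \<in> space ?M. \<not> continuous_on UNIV (\<A> x)} \<subseteq> N" "emeasure ?M N = 0" "N \<in> sets ?M"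
    by (rule AE_E)
  have "(\<lambda>x. if x \<in> N then 0 else \<A> x (g x)) \<in> borel_measurable ?M"
  proof (rule borel_measurable_LIMSEQ_metric)
    show "(\<lambda>x. if x \<in> N then 0 else \<A> x (s i x)) \<in> borel_measurable ?M" for i
      using N(3) m by (intro measurable_If_set) auto
    fix x assume x: "x \<in> space ?M"
    show "(\<lambda>i. if x \<in> N then 0 else \<A> x (s i x)) \<longlonglongrightarrow> (if x \<in> N then 0 else \<A> x (g x))"
    proof (cases "x \<in> N")
      case False
      then have "continuous_on UNIV (\<A> x)" using N(1) x by auto
      then have "isCont (\<A> x) (g x)" by (simp add: continuous_on_eq_continuous_at)
      then have "(\<lambda>i. \<A> x (s i x)) \<longlonglongrightarrow> \<A> x (g x)"
        by (rule isCont_tendsto_compose) (use s(2) x in simp)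
      then show ?thesis using False by simp
    qed simp
  qed
  moreover have "AE x in ?M. (if x \<in> N then 0 else \<A> x (g x)) = \<A> x (g x)"
  proof -
    have "N \<in> null_sets ?M" using N by auto
    then have "AE x in ?M. x \<notin> N" by (rule AE_not_in)
    then show ?thesis by eventually_elim simp
  qed
  ultimately show ?thesis by (rule borel_measurable_lebesgue_on_AE[OF S])
qed

subsection \<open>Approximation in weighted Sobolev spaces\<close>

text \<open>Local integrability gives measurability on compact sets only; a countable cover by
  closed boxes glues the pieces.\<close>

lemma locally_integrable_on_measurable:
  fixes g :: "'a::euclidean_space \<Rightarrow> 'b::euclidean_space"
  assumes "open \<Omega>" "g locally_integrable_on \<Omega>"
  shows "g \<in> borel_measurable (lebesgue_on \<Omega>)"
proof -
  obtain \<D> where \<D>: "countable \<D>" "\<D> \<subseteq> Pow \<Omega>"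
     "\<And>X. X \<in> \<D> \<Longrightarrow> \<exists>a b. X = cbox a b" "\<Union>\<D> = \<Omega>"
    by (rule open_countable_Union_open_cbox[OF assms(1)], rule that)
  show ?thesis
  proof (rule measurable_piecewise_restrict[OF \<D>(1)])
    show "space (lebesgue_on \<Omega>) \<subseteq> \<Union>\<D>" using \<D>(4) by simp
    fix X assume X: "X \<in> \<D>"
    then obtain a b where ab: "X = cbox a b" using \<D>(3) by blast
    have sub: "X \<subseteq> \<Omega>" using X \<D>(2) by blast
    have Xm: "X \<in> sets lebesgue" using ab by simp
    show "X \<inter> space (lebesgue_on \<Omega>) \<in> sets (lebesgue_on \<Omega>)"
      using sub Xm by (auto simp: sets_restrict_space image_iff intro!: bexI[of _ X])
    have "g absolutely_integrable_on X"
      using assms(2) sub ab unfolding locally_integrable_on_def by simp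
    then have "g \<in> borel_measurable (lebesgue_on X)"
      unfolding absolutely_integrable_measurable[OF Xm] by (rule conjunct1)
    moreover have "restrict_space (lebesgue_on \<Omega>) X = lebesgue_on X"
      using sub assms(1) Xm by (subst restrict_restrict_space) (auto simp: Int_absorb1)
    ultimately show "g \<in> borel_measurable (restrict_space (lebesgue_on \<Omega>) X)" by simp
  qed
qed

lemma W1pD:
  assumes "u \<in> W1p p w \<Omega>"
  shows "u \<in> borel_measurable (lebesgue_on \<Omega>)" "has_weak_gradient \<Omega> u (weak_grad \<Omega> u)"
    "integrable (lebesgue_on \<Omega>) (\<lambda>x. \<bar>u x\<bar> powr p * w x)"
    "integrable (lebesgue_on \<Omega>) (\<lambda>x. norm (weak_grad \<Omega> u x) powr p * w x)"
proof -
  show "u \<in> borel_measurable (lebesgue_on \<Omega>)"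
    "integrable (lebesgue_on \<Omega>) (\<lambda>x. \<bar>u x\<bar> powr p * w x)"
    "integrable (lebesgue_on \<Omega>) (\<lambda>x. norm (weak_grad \<Omega> u x) powr p * w x)"
    using assms by (simp_all add: W1p_def)
  have "\<exists>g. has_weak_gradient \<Omega> u g" using assms by (simp add: W1p_def weakly_differentiable_def)
  then show "has_weak_gradient \<Omega> u (weak_grad \<Omega> u)"
    unfolding weak_grad_def by (rule someI_ex)
qed

text \<open>A crude replacement for Minkowski's inequality: the norm of a difference is at most
  twice the larger norm, and the p-th power of a maximum is at most the sum of the p-th
  powers.\<close>

lemma norm_diff_powr_le:
  fixes a b :: "'a::real_normed_vector"
  assumes "0 < p"
  shows "norm (a - b) powr p \<le> 2 powr p * (norm a powr p + norm b powr p)"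
proof -
  have "norm (a - b) \<le> 2 * max (norm a) (norm b)"
    using norm_triangle_ineq4[of a b] by linarith
  then have "norm (a - b) powr p \<le> (2 * max (norm a) (norm b)) powr p"
    using assms by (intro powr_mono2) auto
  also have "\<dots> = 2 powr p * max (norm a) (norm b) powr p"
    by (simp add: powr_mult)
  also have "\<dots> \<le> 2 powr p * (norm a powr p + norm b powr p)"
    by (intro mult_left_mono) (auto simp: max_def)
  finally show ?thesis .
qed

lemma weighted_diff:
  fixes f g :: "'a \<Rightarrow> 'b::euclidean_space"
  assumes p: "0 < p" and w: "AE x in M. 0 \<le> w x"
    and m: "f \<in> borel_measurable M" "g \<in> borel_measurable M" "w \<in> borel_measurable M"
    and f: "integrable M (\<lambda>x. norm (f x) powr p * w x)" and g: "integrable M (\<lambda>x. norm (g x) powr p * w x)"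
  shows "integrable M (\<lambda>x. norm (f x - g x) powr p * w x)"
    "(LINT x|M. norm (f x - g x) powr p * w x) \<le>
      2 powr p * ((LINT x|M. norm (f x) powr p * w x) + (LINT x|M. norm (g x) powr p * w x))"
proof -
  have i: "integrable M (\<lambda>x. 2 powr p * (norm (f x) powr p * w x + norm (g x) powr p * w x))"
    using f g by simp
  have le: "AE x in M. norm (f x - g x) powr p * w x \<le> 2 powr p * (norm (f x) powr p * w x + norm (g x) powr p * w x)"
    using w
  proof eventually_elim
    case (elim x)
    show ?case
      using mult_right_mono[OF norm_diff_powr_le[OF p, of "f x" "g x"] elim] by (simp add: algebra_simps)
  qed
  show 1: "integrable M (\<lambda>x. norm (f x - g x) powr p * w x)"
  proof (rule Bochner_Integration.integrable_bound[OF i])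
    show "(\<lambda>x. norm (f x - g x) powr p * w x) \<in> borel_measurable M" using m by measurable
    show "AE x in M. norm (norm (f x - g x) powr p * w x) \<le>
        norm (2 powr p * (norm (f x) powr p * w x + norm (g x) powr p * w x))"
      using le w by eventually_elim (simp add: abs_mult)
  qed
  show "(LINT x|M. norm (f x - g x) powr p * w x) \<le>
      2 powr p * ((LINT x|M. norm (f x) powr p * w x) + (LINT x|M. norm (g x) powr p * w x))"
    using integral_mono_AE[OF 1 i le] f g by simp
qed

lemma weighted_Cc:
  fixes G :: "'a::euclidean_space \<Rightarrow> 'b::euclidean_space"
  assumes "0 < p" "open \<Omega>" "w locally_integrable_on \<Omega>"
    and G: "continuous_on UNIV G" and K: "compact K" "K \<subseteq> \<Omega>" "\<And>x. x \<notin> K \<Longrightarrow> G x = 0"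
  shows "integrable (lebesgue_on \<Omega>) (\<lambda>x. norm (G x) powr p * w x)"
proof -
  have "integrable (lebesgue_on \<Omega>) (\<lambda>x. w x * norm (G x) powr p)"
  proof (rule locally_integrable_times_continuous[OF assms(3) _ K(1,2) _ assms(2)])
    show "continuous_on UNIV (\<lambda>x. norm (G x) powr p)"
      using assms(1) by (intro continuous_on_powr' continuous_intros G) auto
  qed (simp add: K(3))
  then show ?thesis by (simp add: mult.commute)
qed

text \<open>Smallness of the norm is unpacked into two integrals. Integrability is claimed beside
  the bounds because a non-integrable function has integral 0 by default.\<close>

lemma W1p_0_approx:
  fixes u :: "'a::euclidean_space \<Rightarrow> real"
  assumes p: "0 < p" and \<Omega>: "open \<Omega>" and wi: "w locally_integrable_on \<Omega>"
    and w: "AE x in lebesgue_on \<Omega>. 0 < w x" and u: "u \<in> W1p_0 p w \<Omega>" and d: "0 < d"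
  obtains \<phi> where "\<phi> \<in> Cc_infty \<Omega>"
    "integrable (lebesgue_on \<Omega>) (\<lambda>x. norm (u x - \<phi> x) powr p * w x)"
    "integrable (lebesgue_on \<Omega>) (\<lambda>x. norm (weak_grad \<Omega> u x - grad \<phi> x) powr p * w x)"
    "(LINT x|lebesgue_on \<Omega>. norm (u x - \<phi> x) powr p * w x) < d"
    "(LINT x|lebesgue_on \<Omega>. norm (weak_grad \<Omega> u x - grad \<phi> x) powr p * w x) < d"
proof -
  let ?M = "lebesgue_on \<Omega>"
  have uW: "u \<in> W1p p w \<Omega>" using u by (simp add: W1p_0_def)
  note U = W1pD[OF uW]
  \<comment> \<open>The norm is a sum of p-th roots, so the tolerance for it is the p-th root of
    \<open>d\<close>.\<close>
  have "0 < d powr (1 / p)" using d by simp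
  then obtain \<phi> where \<phi>: "\<phi> \<in> Cc_infty \<Omega>" "norm_W1p p w \<Omega> (\<lambda>x. u x - \<phi> x) < d powr (1 / p)"
    using u unfolding W1p_0_def by blast
  have \<phi>1: "\<phi> \<in> Cc1 \<Omega>" by (rule subsetD[OF Cc_infty_subset_Cc1 \<phi>(1)])
  then have \<phi>C: "C_diff 1 \<phi>" unfolding Cc1_def by blast
  note c = Cc1_gderiv(2,3)[OF \<phi>1]
  obtain K where K: "compact K" "K \<subseteq> \<Omega>" "\<And>x. x \<notin> K \<Longrightarrow> \<phi> x = 0" "\<And>x. x \<notin> K \<Longrightarrow> grad \<phi> x = 0"
    by (rule Cc1_compact_support[OF \<phi>1], rule that)
  have wm: "w \<in> borel_measurable ?M" by (rule locally_integrable_on_measurable[OF \<Omega> wi])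
  have w0: "AE x in ?M. 0 \<le> w x" using w by eventually_elim simp
  have hw: "has_weak_gradient \<Omega> \<phi> (grad \<phi>)" by (rule has_weak_gradient_C1[OF \<phi>C \<Omega>])
  have gm: "weak_grad \<Omega> u \<in> borel_measurable ?M"
    by (rule locally_integrable_on_measurable[OF \<Omega> has_weak_gradientD(2)[OF U(2)]])
  have \<phi>m: "\<phi> \<in> borel_measurable ?M" "grad \<phi> \<in> borel_measurable ?M"
    by (intro locally_integrable_on_measurable[OF \<Omega>] has_weak_gradientD(1,2)[OF hw])+
  have i1: "integrable ?M (\<lambda>x. norm (u x - \<phi> x) powr p * w x)"
    using U(3) by (intro weighted_diff[OF p w0 U(1) \<phi>m(1) wm] weighted_Cc[OF p \<Omega> wi c(2) K(1,2,3)]) simp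
  have i2: "integrable ?M (\<lambda>x. norm (weak_grad \<Omega> u x - grad \<phi> x) powr p * w x)"
    by (rule weighted_diff[OF p w0 gm \<phi>m(2) wm U(4) weighted_Cc[OF p \<Omega> wi c(1) K(1,2,4)]])
  have dw: "has_weak_gradient \<Omega> (\<lambda>x. u x - \<phi> x) (\<lambda>x. weak_grad \<Omega> u x - grad \<phi> x)"
    by (rule has_weak_gradient_diff[OF U(2) hw \<Omega>])
  \<comment> \<open>The norm contains the chosen gradient of the difference, which agrees with the
    difference of the gradients only almost everywhere.\<close>
  have ae: "AE x in ?M. weak_grad \<Omega> (\<lambda>x. u x - \<phi> x) x = weak_grad \<Omega> u x - grad \<phi> x"
    by (rule weak_grad_AE[OF dw \<Omega>])
  have wg: "weak_grad \<Omega> (\<lambda>x. u x - \<phi> x) \<in> borel_measurable ?M"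
    by (rule borel_measurable_lebesgue_on_AE[of \<Omega> "\<lambda>x. weak_grad \<Omega> u x - grad \<phi> x"])
      (use \<Omega> gm \<phi>m(2) ae in \<open>auto elim: eventually_mono\<close>)
  have eq: "(LINT x|?M. norm (weak_grad \<Omega> (\<lambda>x. u x - \<phi> x) x) powr p * w x) =
      (LINT x|?M. norm (weak_grad \<Omega> u x - grad \<phi> x) powr p * w x)"
  proof (rule integral_cong_AE)
    show "(\<lambda>x. norm (weak_grad \<Omega> (\<lambda>x. u x - \<phi> x) x) powr p * w x) \<in> borel_measurable ?M"
      using wg wm by measurable
    show "(\<lambda>x. norm (weak_grad \<Omega> u x - grad \<phi> x) powr p * w x) \<in> borel_measurable ?M"
      using i2 by (rule borel_measurable_integrable)
    show "AE x in ?M. norm (weak_grad \<Omega> (\<lambda>x. u x - \<phi> x) x) powr p * w x =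
        norm (weak_grad \<Omega> u x - grad \<phi> x) powr p * w x"
      using ae by eventually_elim simp
  qed
  define I where "I = (LINT x|?M. norm (u x - \<phi> x) powr p * w x)"
  define J where "J = (LINT x|?M. norm (weak_grad \<Omega> u x - grad \<phi> x) powr p * w x)"
  have nn: "0 \<le> I" "0 \<le> J" unfolding I_def J_def
    by (intro integral_nonneg_AE, use w0 in eventually_elim, simp)+
  have "I powr (1 / p) + J powr (1 / p) < d powr (1 / p)"
    using \<phi>(2) eq unfolding norm_W1p_def I_def J_def by simp
  then have "I powr (1 / p) < d powr (1 / p)" "J powr (1 / p) < d powr (1 / p)"
    using powr_ge_zero[of I "1/p"] powr_ge_zero[of J "1/p"] by linarith+
  then have "I < d" "J < d"
    using powr_mono2[of "1 / p" d I] powr_mono2[of "1 / p" d J] d p by (auto simp: not_less[symmetric])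
  then show thesis using that[OF \<phi>(1) i1 i2] unfolding I_def J_def by simp
qed

text \<open>Approximants of \<open>u\<close> and of \<open>v\<close> are subtracted, so it need not
  be shown that u - v lies in the space. Convergence almost everywhere is obtained by passing to a
  subsequence.\<close>

lemma W1p_0_diff_approx:
  fixes u v :: "'a::euclidean_space \<Rightarrow> real"
  assumes p: "0 < p" and \<Omega>: "open \<Omega>" and wi: "w locally_integrable_on \<Omega>"
    and w: "AE x in lebesgue_on \<Omega>. 0 < w x" and u: "u \<in> W1p_0 p w \<Omega>" and v: "v \<in> W1p_0 p w \<Omega>"
  obtains \<zeta> :: "nat \<Rightarrow> 'a \<Rightarrow> real" where "\<And>n. \<zeta> n \<in> Cc1 \<Omega>"
    "AE x in lebesgue_on \<Omega>. (\<lambda>n. \<zeta> n x) \<longlonglongrightarrow> u x - v x"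
    "\<And>n. integrable (lebesgue_on \<Omega>)
      (\<lambda>x. norm (grad (\<zeta> n) x - (weak_grad \<Omega> u x - weak_grad \<Omega> v x)) powr p * w x)"
    "(\<lambda>n. LINT x|lebesgue_on \<Omega>.
      norm (grad (\<zeta> n) x - (weak_grad \<Omega> u x - weak_grad \<Omega> v x)) powr p * w x) \<longlonglongrightarrow> 0"
proof -
  let ?M = "lebesgue_on \<Omega>"
  define \<epsilon> where "\<epsilon> n = inverse (real (Suc n))" for n
  have \<epsilon>: "0 < \<epsilon> n" for n by (simp add: \<epsilon>_def)
  have w0: "AE x in ?M. 0 \<le> w x" using w by eventually_elim simp
  have wm: "w \<in> borel_measurable ?M" by (rule locally_integrable_on_measurable[OF \<Omega> wi])
  define P where "P u \<phi> n \<longleftrightarrow> \<phi> \<in> Cc_infty \<Omega> \<and>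
    integrable ?M (\<lambda>x. norm (u x - \<phi> x) powr p * w x) \<and>
    integrable ?M (\<lambda>x. norm (weak_grad \<Omega> u x - grad \<phi> x) powr p * w x) \<and>
    (LINT x|?M. norm (u x - \<phi> x) powr p * w x) < \<epsilon> n \<and>
    (LINT x|?M. norm (weak_grad \<Omega> u x - grad \<phi> x) powr p * w x) < \<epsilon> n" for u \<phi> n
  have exP: "\<exists>\<phi>. P s \<phi> n" if s: "s \<in> W1p_0 p w \<Omega>" for s n
  proof -
    obtain \<phi> where "\<phi> \<in> Cc_infty \<Omega>"
      "integrable (lebesgue_on \<Omega>) (\<lambda>x. norm (s x - \<phi> x) powr p * w x)"
      "integrable (lebesgue_on \<Omega>) (\<lambda>x. norm (weak_grad \<Omega> s x - grad \<phi> x) powr p * w x)"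
      "(LINT x|lebesgue_on \<Omega>. norm (s x - \<phi> x) powr p * w x) < \<epsilon> n"
      "(LINT x|lebesgue_on \<Omega>. norm (weak_grad \<Omega> s x - grad \<phi> x) powr p * w x) < \<epsilon> n"
      by (rule W1p_0_approx[OF p \<Omega> wi w s \<epsilon>], rule that)
    then show ?thesis unfolding P_def by blast
  qed
  define \<phi> where "\<phi> n = (SOME \<phi>. P u \<phi> n)" for n
  define \<eta> where "\<eta> n = (SOME \<phi>. P v \<phi> n)" for n
  have \<phi>P: "P u (\<phi> n) n" for n unfolding \<phi>_def by (rule someI_ex[OF exP[OF u]])
  have \<eta>P: "P v (\<eta> n) n" for n unfolding \<eta>_def by (rule someI_ex[OF exP[OF v]])
  have \<phi>: "\<phi> n \<in> Cc1 \<Omega>" "integrable ?M (\<lambda>x. norm (u x - \<phi> n x) powr p * w x)"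
    "integrable ?M (\<lambda>x. norm (weak_grad \<Omega> u x - grad (\<phi> n) x) powr p * w x)"
    "(LINT x|?M. norm (u x - \<phi> n x) powr p * w x) < \<epsilon> n"
    "(LINT x|?M. norm (weak_grad \<Omega> u x - grad (\<phi> n) x) powr p * w x) < \<epsilon> n" for n
    using \<phi>P[of n] subsetD[OF Cc_infty_subset_Cc1] unfolding P_def by blast+
  have \<eta>: "\<eta> n \<in> Cc1 \<Omega>" "integrable ?M (\<lambda>x. norm (v x - \<eta> n x) powr p * w x)"
    "integrable ?M (\<lambda>x. norm (weak_grad \<Omega> v x - grad (\<eta> n) x) powr p * w x)"
    "(LINT x|?M. norm (v x - \<eta> n x) powr p * w x) < \<epsilon> n"
    "(LINT x|?M. norm (weak_grad \<Omega> v x - grad (\<eta> n) x) powr p * w x) < \<epsilon> n" for n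
    using \<eta>P[of n] subsetD[OF Cc_infty_subset_Cc1] unfolding P_def by blast+
  define \<zeta> where "\<zeta> n x = \<phi> n x - \<eta> n x" for n x
  have g: "grad (\<zeta> n) x = grad (\<phi> n) x - grad (\<eta> n) x" for n x
    unfolding \<zeta>_def[abs_def]
    by (intro grad_eqI GDERIV_diff Cc1_gderiv(1)[OF \<phi>(1)] Cc1_gderiv(1)[OF \<eta>(1)])
  have \<zeta>: "\<zeta> n \<in> Cc1 \<Omega>" for n
  proof -
    obtain K where K: "compact K" "K \<subseteq> \<Omega>" "\<And>x. x \<notin> K \<Longrightarrow> \<phi> n x = 0" "\<And>x. x \<notin> K \<Longrightarrow> grad (\<phi> n) x = 0"
      by (rule Cc1_compact_support[OF \<phi>(1)], rule that)
    obtain L where L: "compact L" "L \<subseteq> \<Omega>" "\<And>x. x \<notin> L \<Longrightarrow> \<eta> n x = 0" "\<And>x. x \<notin> L \<Longrightarrow> grad (\<eta> n) x = 0"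
      by (rule Cc1_compact_support[OF \<eta>(1)], rule that)
    have "compactly_contained {x. \<zeta> n x \<noteq> 0} \<Omega>"
    proof (rule compactly_containedI[of "K \<union> L"])
      show "compact (K \<union> L)" "K \<union> L \<subseteq> \<Omega>" using K L by auto
      show "\<zeta> n x = 0" if "x \<notin> K \<union> L" for x using that K(3)[of x] L(3)[of x] by (simp add: \<zeta>_def)
    qed
    moreover have "C_diff 1 (\<zeta> n)"
    proof (rule C_diff_1I)
      show "GDERIV (\<zeta> n) x :> grad (\<phi> n) x - grad (\<eta> n) x" for x
        unfolding \<zeta>_def[abs_def]
        by (intro GDERIV_diff Cc1_gderiv(1)[OF \<phi>(1)] Cc1_gderiv(1)[OF \<eta>(1)])
      show "continuous_on UNIV (\<lambda>x. grad (\<phi> n) x - grad (\<eta> n) x)"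
        by (intro continuous_on_diff Cc1_gderiv(2)[OF \<phi>(1)] Cc1_gderiv(2)[OF \<eta>(1)])
    qed
    ultimately show ?thesis unfolding Cc1_def by blast
  qed
  have W: "u \<in> W1p p w \<Omega>" "v \<in> W1p p w \<Omega>" using u v by (simp_all add: W1p_0_def)
  have gm: "s \<in> borel_measurable ?M" "weak_grad \<Omega> s \<in> borel_measurable ?M" if "s \<in> W1p p w \<Omega>" for s
    by (intro locally_integrable_on_measurable[OF \<Omega>] has_weak_gradientD(1,2)[OF W1pD(2)[OF that]])+
  have cm: "\<psi> \<in> borel_measurable ?M" "grad \<psi> \<in> borel_measurable ?M" if "\<psi> \<in> Cc1 \<Omega>" for \<psi>
    by (intro locally_integrable_on_measurable[OF \<Omega>] continuous_locally_integrable_on Cc1_gderiv(2,3)[OF that])+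
  have m: "(\<lambda>x. u x - \<phi> n x) \<in> borel_measurable ?M" "(\<lambda>x. v x - \<eta> n x) \<in> borel_measurable ?M"
    "(\<lambda>x. weak_grad \<Omega> u x - grad (\<phi> n) x) \<in> borel_measurable ?M"
    "(\<lambda>x. weak_grad \<Omega> v x - grad (\<eta> n) x) \<in> borel_measurable ?M" for n
    using gm[OF W(1)] gm[OF W(2)] cm[OF \<phi>(1)] cm[OF \<eta>(1)] by simp_all
  have e1: "norm ((u x - \<phi> n x) - (v x - \<eta> n x)) = \<bar>\<zeta> n x - (u x - v x)\<bar>" for n x
    unfolding \<zeta>_def by (simp add: abs_minus_commute algebra_simps)
  have e2: "norm ((weak_grad \<Omega> u x - grad (\<phi> n) x) - (weak_grad \<Omega> v x - grad (\<eta> n) x)) =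
      norm (grad (\<zeta> n) x - (weak_grad \<Omega> u x - weak_grad \<Omega> v x))" for n x
    unfolding g by (subst norm_minus_commute) (simp add: algebra_simps)
  have d1: "integrable ?M (\<lambda>x. \<bar>\<zeta> n x - (u x - v x)\<bar> powr p * w x)"
    "(LINT x|?M. \<bar>\<zeta> n x - (u x - v x)\<bar> powr p * w x) \<le>
      2 powr p * ((LINT x|?M. norm (u x - \<phi> n x) powr p * w x) + (LINT x|?M. norm (v x - \<eta> n x) powr p * w x))" for n
    using weighted_diff[OF p w0 m(1)[of n] m(2)[of n] wm \<phi>(2) \<eta>(2)] unfolding e1 .
  have d2: "integrable ?M (\<lambda>x. norm (grad (\<zeta> n) x - (weak_grad \<Omega> u x - weak_grad \<Omega> v x)) powr p * w x)"
    "(LINT x|?M. norm (grad (\<zeta> n) x - (weak_grad \<Omega> u x - weak_grad \<Omega> v x)) powr p * w x) \<le>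
      2 powr p * ((LINT x|?M. norm (weak_grad \<Omega> u x - grad (\<phi> n) x) powr p * w x) +
        (LINT x|?M. norm (weak_grad \<Omega> v x - grad (\<eta> n) x) powr p * w x))" for n
    using weighted_diff[OF p w0 m(3)[of n] m(4)[of n] wm \<phi>(3) \<eta>(3)] unfolding e2 .
  have e0: "(\<lambda>n. 2 powr p * (\<epsilon> n + \<epsilon> n)) \<longlonglongrightarrow> 0"
  proof -
    have "(\<lambda>n. 2 powr p * (\<epsilon> n + \<epsilon> n)) \<longlonglongrightarrow> 2 powr p * (0 + 0)"
      unfolding \<epsilon>_def by (intro tendsto_intros LIMSEQ_inverse_real_of_nat)
    then show ?thesis by simp
  qed
  have to0: "a \<longlonglongrightarrow> 0" if "\<And>n. 0 \<le> a n" "\<And>n. a n \<le> 2 powr p * (b n + c n)" "\<And>n. b n < \<epsilon> n" "\<And>n. c n < \<epsilon> n" for a b c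
  proof (rule tendsto_sandwich[OF _ _ tendsto_const e0])
    have "a n \<le> 2 powr p * (\<epsilon> n + \<epsilon> n)" for n
      using order_trans[OF that(2)[of n] mult_left_mono[OF add_mono[OF less_imp_le[OF that(3)] less_imp_le[OF that(4)]]]]
      by simp
    then show "\<forall>\<^sub>F n in sequentially. a n \<le> 2 powr p * (\<epsilon> n + \<epsilon> n)" by simp
    show "\<forall>\<^sub>F n in sequentially. 0 \<le> a n" using that(1) by simp
  qed
  have nn: "0 \<le> (LINT x|?M. k x powr p * w x)" for k
    by (rule integral_nonneg_AE) (use w0 in eventually_elim, simp)
  have l1: "(\<lambda>n. LINT x|?M. \<bar>\<zeta> n x - (u x - v x)\<bar> powr p * w x) \<longlonglongrightarrow> 0"
    by (rule to0[OF _ d1(2) \<phi>(4) \<eta>(4)]) (rule nn)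
  have l2: "(\<lambda>n. LINT x|?M. norm (grad (\<zeta> n) x - (weak_grad \<Omega> u x - weak_grad \<Omega> v x)) powr p * w x) \<longlonglongrightarrow> 0"
    by (rule to0[OF _ d2(2) \<phi>(5) \<eta>(5)]) (rule nn)
  have "(LINT x|?M. norm (\<bar>\<zeta> n x - (u x - v x)\<bar> powr p * w x)) = (LINT x|?M. \<bar>\<zeta> n x - (u x - v x)\<bar> powr p * w x)" for n
  proof (rule integral_cong_AE)
    show "(\<lambda>x. \<bar>\<zeta> n x - (u x - v x)\<bar> powr p * w x) \<in> borel_measurable ?M"
      "(\<lambda>x. norm (\<bar>\<zeta> n x - (u x - v x)\<bar> powr p * w x)) \<in> borel_measurable ?M"
      using borel_measurable_integrable[OF d1(1)] by simp_all
    show "AE x in ?M. norm (\<bar>\<zeta> n x - (u x - v x)\<bar> powr p * w x) = \<bar>\<zeta> n x - (u x - v x)\<bar> powr p * w x"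
      using w0 by eventually_elim simp
  qed
  with l1 have "(\<lambda>n. LINT x|?M. norm (\<bar>\<zeta> n x - (u x - v x)\<bar> powr p * w x)) \<longlonglongrightarrow> 0" by simp
  from tendsto_L1_AE_subseq[OF d1(1) this]
  \<comment> \<open>Convergence in L^1 of the weighted powers gives almost everywhere convergence
    along \<open>r\<close>; dividing by w > 0 and taking p-th roots then removes the weight and the
    power.\<close>
  obtain r :: "nat \<Rightarrow> nat" where r: "strict_mono r"
    "AE x in ?M. (\<lambda>n. \<bar>\<zeta> (r n) x - (u x - v x)\<bar> powr p * w x) \<longlonglongrightarrow> 0" by blast
  have "AE x in ?M. (\<lambda>n. \<zeta> (r n) x) \<longlonglongrightarrow> u x - v x"
    using r(2) w
  proof eventually_elim
    case (elim x)
    have "(\<lambda>n. (\<bar>\<zeta> (r n) x - (u x - v x)\<bar> powr p * w x) / w x) \<longlonglongrightarrow> 0 / w x"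
      using elim by (intro tendsto_divide tendsto_const) auto
    then have "(\<lambda>n. \<bar>\<zeta> (r n) x - (u x - v x)\<bar> powr p) \<longlonglongrightarrow> 0"
      using elim(2) by simp
    then have "(\<lambda>n. (\<bar>\<zeta> (r n) x - (u x - v x)\<bar> powr p) powr (1 / p)) \<longlonglongrightarrow> 0 powr (1 / p)"
      using p by (intro tendsto_powr') auto
    then have "(\<lambda>n. \<bar>\<zeta> (r n) x - (u x - v x)\<bar>) \<longlonglongrightarrow> 0"
      using p by (simp add: powr_powr)
    then show ?case by (simp add: LIM_zero_iff tendsto_rabs_zero_iff)
  qed
  moreover note d2(1)
  moreover have "(\<lambda>n. LINT x|?M. norm (grad (\<zeta> (r n)) x - (weak_grad \<Omega> u x - weak_grad \<Omega> v x)) powr p * w x) \<longlonglongrightarrow> 0"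
    using LIMSEQ_subseq_LIMSEQ[OF l2 r(1)] by (simp add: o_def)
  ultimately show thesis using \<zeta> by (intro that[of "\<lambda>n. \<zeta> (r n)"])
qed

subsection \<open>The operator and the singular term\<close>

lemma structural_conditionsD:
  assumes "structural_conditions p w \<Omega> \<A>"
  shows "Caratheodory \<Omega> \<A>"
    "AE x in lebesgue_on \<Omega>. \<forall>\<zeta>. norm (\<A> x \<zeta>) \<le> norm \<zeta> powr (p - 1) * w x"
    "AE x in lebesgue_on \<Omega>. \<forall>\<zeta>. norm \<zeta> powr p * w x \<le> \<A> x \<zeta> \<bullet> \<zeta>"
    "\<exists>c>0. AE x in lebesgue_on \<Omega>. \<forall>\<zeta>\<^sub>1 \<zeta>\<^sub>2. \<zeta>\<^sub>1 \<noteq> \<zeta>\<^sub>2 \<longrightarrow>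
        c * norm (\<zeta>\<^sub>1 - \<zeta>\<^sub>2) powr (max p 2) * A_bar w \<A> x \<zeta>\<^sub>1 \<zeta>\<^sub>2 powr (1 - max p 2 / p) * w x
        \<le> (\<A> x \<zeta>\<^sub>1 - \<A> x \<zeta>\<^sub>2) \<bullet> (\<zeta>\<^sub>1 - \<zeta>\<^sub>2)"
  using assms unfolding structural_conditions_def Let_def by blast+

text \<open>The lower bound in the monotonicity condition is positive only if \<open>A_bar\<close>
  is not 0, since \<open>powr\<close> sends 0 to 0 for every exponent. Degeneracy bounds
  \<open>A_bar\<close> below by the sum of the p-th powers of the norms, and two distinct vectors
  are not both 0.\<close>

lemma structural_conditions_strict:
  assumes A: "structural_conditions p w \<Omega> \<A>" and w: "AE x in lebesgue_on \<Omega>. 0 < w x"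
  shows "AE x in lebesgue_on \<Omega>. \<forall>\<zeta> \<xi>. \<zeta> \<noteq> \<xi> \<longrightarrow> 0 < (\<A> x \<zeta> - \<A> x \<xi>) \<bullet> (\<zeta> - \<xi>)"
proof -
  obtain c where c: "0 < c" "AE x in lebesgue_on \<Omega>. \<forall>\<zeta>\<^sub>1 \<zeta>\<^sub>2. \<zeta>\<^sub>1 \<noteq> \<zeta>\<^sub>2 \<longrightarrow>
        c * norm (\<zeta>\<^sub>1 - \<zeta>\<^sub>2) powr (max p 2) * A_bar w \<A> x \<zeta>\<^sub>1 \<zeta>\<^sub>2 powr (1 - max p 2 / p) * w x
        \<le> (\<A> x \<zeta>\<^sub>1 - \<A> x \<zeta>\<^sub>2) \<bullet> (\<zeta>\<^sub>1 - \<zeta>\<^sub>2)"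
    using structural_conditionsD(4)[OF A] by blast
  from c(2) structural_conditionsD(3)[OF A] w show ?thesis
  proof eventually_elim
    case (elim x)
    show ?case
    proof (intro allI impI)
      fix \<zeta> \<xi> :: 'a assume ne: "\<zeta> \<noteq> \<xi>"
      have "norm \<zeta> powr p * w x + norm \<xi> powr p * w x \<le> \<A> x \<zeta> \<bullet> \<zeta> + \<A> x \<xi> \<bullet> \<xi>"
        using elim(2) by (intro add_mono) simp_all
      moreover have "0 < norm \<zeta> powr p * w x + norm \<xi> powr p * w x"
      proof (cases "\<zeta> = 0")
        case True
        then have "\<xi> \<noteq> 0" using ne by simp
        then have "0 < norm \<xi> powr p * w x" using elim(3) by simp
        then show ?thesis using elim(3) by (simp add: add_nonneg_pos)
      next
        case False
        then have "0 < norm \<zeta> powr p * w x" using elim(3) by simp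
        then show ?thesis using elim(3) by (simp add: add_pos_nonneg)
      qed
      ultimately have "0 < A_bar w \<A> x \<zeta> \<xi>" using elim(3) by (simp add: A_bar_def)
      then have "0 < c * norm (\<zeta> - \<xi>) powr (max p 2) * A_bar w \<A> x \<zeta> \<xi> powr (1 - max p 2 / p) * w x"
        using c(1) elim(3) ne by simp
      also have "\<dots> \<le> (\<A> x \<zeta> - \<A> x \<xi>) \<bullet> (\<zeta> - \<xi>)" using elim(1) ne by simp
      finally show "0 < (\<A> x \<zeta> - \<A> x \<xi>) \<bullet> (\<zeta> - \<xi>)" .
    qed
  qed
qed

lemma operator_measurable:
  fixes u :: "'a::euclidean_space \<Rightarrow> real"
  assumes \<Omega>: "open \<Omega>" and A: "structural_conditions p w \<Omega> \<A>" and u: "u \<in> W1p p w \<Omega>"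
  shows "(\<lambda>x. \<A> x (weak_grad \<Omega> u x)) \<in> borel_measurable (lebesgue_on \<Omega>)"
proof (rule Caratheodory_measurable[where \<A>=\<A> and g="weak_grad \<Omega> u"])
  show "\<Omega> \<in> sets lebesgue" using \<Omega> by auto
  show "Caratheodory \<Omega> \<A>" by (rule structural_conditionsD(1)[OF A])
  show "weak_grad \<Omega> u \<in> borel_measurable (lebesgue_on \<Omega>)"
    by (rule locally_integrable_on_measurable[OF \<Omega> has_weak_gradientD(2)[OF W1pD(2)[OF u]]])
qed

lemma operator_bound:
  assumes A: "structural_conditions p w \<Omega> \<A>"
  shows "AE x in lebesgue_on \<Omega>. \<bar>\<A> x (g x) \<bullet> d x\<bar> \<le> norm (g x) powr (p - 1) * norm (d x) * w x"
  using structural_conditionsD(2)[OF A]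
proof eventually_elim
  case (elim x)
  have "\<bar>\<A> x (g x) \<bullet> d x\<bar> \<le> norm (\<A> x (g x)) * norm (d x)" by (rule Cauchy_Schwarz_ineq2)
  also have "\<dots> \<le> (norm (g x) powr (p - 1) * w x) * norm (d x)"
    using elim by (intro mult_right_mono) simp_all
  finally show ?case by (simp add: mult_ac)
qed

text \<open>Growth bounds the integrand by |\<nabla>u|^(p-1) |d| w, so the weighted product bound
  applies with H = |\<nabla>u|.\<close>

lemma operator_integrable:
  fixes u :: "'a::euclidean_space \<Rightarrow> real"
  assumes p: "1 < p" and \<Omega>: "open \<Omega>" and w: "AE x in lebesgue_on \<Omega>. 0 \<le> w x"
    and A: "structural_conditions p w \<Omega> \<A>" and u: "u \<in> W1p p w \<Omega>"
    and d: "d \<in> borel_measurable (lebesgue_on \<Omega>)" "integrable (lebesgue_on \<Omega>) (\<lambda>x. norm (d x) powr p * w x)"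
  shows "integrable (lebesgue_on \<Omega>) (\<lambda>x. \<A> x (weak_grad \<Omega> u x) \<bullet> d x)"
proof (rule weighted_product_bound(1)[OF p w, where H="\<lambda>x. norm (weak_grad \<Omega> u x)" and h="\<lambda>x. norm (d x)"])
  show "(\<lambda>x. \<A> x (weak_grad \<Omega> u x) \<bullet> d x) \<in> borel_measurable (lebesgue_on \<Omega>)"
    by (rule borel_measurable_inner[OF operator_measurable[OF \<Omega> A u] d(1)])
qed (simp_all add: operator_bound[OF A] W1pD(4)[OF u] d(2))

lemma operator_tendsto_0:
  fixes u :: "'a::euclidean_space \<Rightarrow> real" and d :: "nat \<Rightarrow> 'a \<Rightarrow> 'a"
  assumes p: "1 < p" and \<Omega>: "open \<Omega>" and w: "AE x in lebesgue_on \<Omega>. 0 \<le> w x"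
    and A: "structural_conditions p w \<Omega> \<A>" and u: "u \<in> W1p p w \<Omega>"
    and d: "\<And>n. d n \<in> borel_measurable (lebesgue_on \<Omega>)"
      "\<And>n. integrable (lebesgue_on \<Omega>) (\<lambda>x. norm (d n x) powr p * w x)"
      "(\<lambda>n. LINT x|lebesgue_on \<Omega>. norm (d n x) powr p * w x) \<longlonglongrightarrow> 0"
  shows "(\<lambda>n. LINT x|lebesgue_on \<Omega>. \<bar>\<A> x (weak_grad \<Omega> u x) \<bullet> d n x\<bar>) \<longlonglongrightarrow> 0"
proof (rule weighted_product_tendsto_0[OF p w, where H="\<lambda>x. norm (weak_grad \<Omega> u x)" and h="\<lambda>n x. norm (d n x)"])
  show "(\<lambda>x. \<A> x (weak_grad \<Omega> u x) \<bullet> d n x) \<in> borel_measurable (lebesgue_on \<Omega>)" for n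
    by (rule borel_measurable_inner[OF operator_measurable[OF \<Omega> A u] d(1)])
qed (simp_all add: operator_bound[OF A] W1pD(4)[OF u] d(2,3))

text \<open>On the support of \<psi> the local lower bound keeps the negative power of
  \<open>u\<close> bounded, and \<open>f\<close> is integrable.\<close>

lemma singular_term_integrable:
  fixes f u \<psi> :: "'a::euclidean_space \<Rightarrow> real"
  assumes \<Omega>: "open \<Omega>" and \<delta>: "0 < \<delta>" and f: "integrable (lebesgue_on \<Omega>) f"
    and u: "u \<in> borel_measurable (lebesgue_on \<Omega>)"
    and lower: "\<And>K. compactly_contained K \<Omega> \<Longrightarrow> \<exists>c>0. AE x in lebesgue. x \<in> K \<longrightarrow> u x \<ge> c"
    and \<psi>: "\<psi> \<in> Cc1 \<Omega>"
  shows "integrable (lebesgue_on \<Omega>) (\<lambda>x. f x / u x powr \<delta> * \<psi> x)"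
proof -
  obtain K where K: "compact K" "K \<subseteq> \<Omega>" "\<And>x. x \<notin> K \<Longrightarrow> \<psi> x = 0" "\<And>x. x \<notin> K \<Longrightarrow> grad \<psi> x = 0"
    by (rule Cc1_compact_support[OF \<psi>], rule that)
  have "compactly_contained K \<Omega>"
    using K by (simp add: compactly_contained_def closure_closed compact_imp_closed)
  then obtain c where c: "0 < c" "AE x in lebesgue. x \<in> K \<longrightarrow> u x \<ge> c" using lower by blast
  have "bounded (\<psi> ` K)"
    by (intro compact_imp_bounded compact_continuous_image Cc1_gderiv(3)[OF \<psi>] K(1))
  then obtain B where B: "\<And>x. x \<in> K \<Longrightarrow> \<bar>\<psi> x\<bar> \<le> B" by (auto simp: bounded_iff)
  have \<psi>m: "\<psi> \<in> borel_measurable (lebesgue_on \<Omega>)"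
    by (intro locally_integrable_on_measurable[OF \<Omega>] continuous_locally_integrable_on Cc1_gderiv(3)[OF \<psi>])
  have ae: "AE x in lebesgue_on \<Omega>. x \<in> K \<longrightarrow> u x \<ge> c"
    using c(2) \<Omega> by (subst AE_restrict_space_iff) (auto elim: eventually_mono)
  show ?thesis
  proof (rule Bochner_Integration.integrable_bound)
    show "integrable (lebesgue_on \<Omega>) (\<lambda>x. (\<bar>B\<bar> / c powr \<delta>) * f x)" using f by simp
    show "(\<lambda>x. f x / u x powr \<delta> * \<psi> x) \<in> borel_measurable (lebesgue_on \<Omega>)"
      using f u \<psi>m by measurable
    show "AE x in lebesgue_on \<Omega>. norm (f x / u x powr \<delta> * \<psi> x) \<le> norm ((\<bar>B\<bar> / c powr \<delta>) * f x)"
      using ae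
    proof eventually_elim
      case (elim x)
      show ?case
      proof (cases "x \<in> K")
        case True
        then have "c powr \<delta> \<le> u x powr \<delta>" using elim c(1) \<delta> by (intro powr_mono2) auto
        then have "\<bar>f x\<bar> / u x powr \<delta> \<le> \<bar>f x\<bar> / c powr \<delta>"
          using c(1) by (intro frac_le) auto
        moreover have "\<bar>\<psi> x\<bar> \<le> \<bar>B\<bar>" using B[OF True] by simp
        ultimately have "(\<bar>f x\<bar> / u x powr \<delta>) * \<bar>\<psi> x\<bar> \<le> (\<bar>f x\<bar> / c powr \<delta>) * \<bar>B\<bar>"
          by (intro mult_mono) auto
        then show ?thesis by (simp add: abs_mult mult_ac)
      qed (simp add: K(3))
    qed
  qed
qed

text \<open>The support stays compact in \<Omega> because \<open>step\<close> vanishes at 0.\<close>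

lemma Cc1_step:
  assumes "\<zeta> \<in> Cc1 \<Omega>"
  shows "(\<lambda>x. step (\<zeta> x)) \<in> Cc1 \<Omega>" "grad (\<lambda>x. step (\<zeta> x)) x = dstep (\<zeta> x) *\<^sub>R grad \<zeta> x"
proof -
  have d: "GDERIV (\<lambda>x. step (\<zeta> x)) x :> dstep (\<zeta> x) *\<^sub>R grad \<zeta> x" for x
    by (rule GDERIV_DERIV_compose[OF Cc1_gderiv(1)[OF assms] DERIV_step])
  then show "grad (\<lambda>x. step (\<zeta> x)) x = dstep (\<zeta> x) *\<^sub>R grad \<zeta> x" by (rule grad_eqI)
  have "continuous_on UNIV (\<lambda>x. dstep (\<zeta> x) *\<^sub>R grad \<zeta> x)"
    by (intro continuous_on_scaleR continuous_on_compose2[OF continuous_step(2)[of UNIV]]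
      Cc1_gderiv(2,3)[OF assms]) auto
  from C_diff_1I(1)[OF d this] have "C_diff 1 (\<lambda>x. step (\<zeta> x))" .
  moreover obtain K where K: "compact K" "K \<subseteq> \<Omega>" "\<And>x. x \<notin> K \<Longrightarrow> \<zeta> x = 0" "\<And>x. x \<notin> K \<Longrightarrow> grad \<zeta> x = 0"
    by (rule Cc1_compact_support[OF assms], rule that)
  moreover have "compactly_contained {x. step (\<zeta> x) \<noteq> 0} \<Omega>"
    by (rule compactly_containedI[OF K(1,2)]) (simp add: K(3) step_nonpos)
  ultimately show "(\<lambda>x. step (\<zeta> x)) \<in> Cc1 \<Omega>" unfolding Cc1_def by blast
qed

lemma step_measurable:
  assumes "z \<in> borel_measurable M"
  shows "(\<lambda>x. step (z x)) \<in> borel_measurable M" "(\<lambda>x. dstep (z x)) \<in> borel_measurable M"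
  by (intro measurable_compose[OF assms] borel_measurable_continuous_onI continuous_step)+

lemma step_isCont: "isCont step t" "isCont dstep t"
  using continuous_step[of UNIV] by (simp_all add: continuous_on_eq_continuous_at)

text \<open>A bounded domain lies in a ball, where the A_p condition provides the integrability.
  This is what later turns weighted convergence of gradients into unweighted L^1
  convergence.\<close>

lemma A_weight_dual_integrable:
  fixes w :: "'a::euclidean_space \<Rightarrow> real"
  assumes "A_weight p w" "open \<Omega>" "bounded \<Omega>"
  shows "integrable (lebesgue_on \<Omega>) (\<lambda>x. w x powr (- 1 / (p - 1)))"
proof -
  obtain r where r: "0 < r" "\<Omega> \<subseteq> ball 0 r"
    using bounded_subset_ballD[OF assms(3), of 0] by blast
  have "integrable (lebesgue_on (ball 0 r)) (\<lambda>x. w x powr (- 1 / (p - 1)))"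
    using assms(1) r(1) unfolding A_weight_def by blast
  then have "set_integrable lebesgue (ball 0 r) (\<lambda>x. w x powr (- 1 / (p - 1)))"
    unfolding set_integrable_def by (subst (asm) integrable_restrict_space) auto
  then have "set_integrable lebesgue \<Omega> (\<lambda>x. w x powr (- 1 / (p - 1)))"
    by (rule set_integrable_subset) (use assms(2) r(2) in auto)
  then show ?thesis
    unfolding set_integrable_def using assms(2) by (subst integrable_restrict_space) auto
qed

subsection \<open>Uniqueness\<close>

lemma weak_solutions_le:
  fixes \<Omega> :: "'a::euclidean_space set" and w f u v :: "'a \<Rightarrow> real"
  assumes \<Omega>: "open \<Omega>" "bounded \<Omega>" and p: "1 < p" and \<delta>: "0 < \<delta>" and Ap: "A_weight p w"
    and A: "structural_conditions p w \<Omega> \<A>"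
    and f: "integrable (lebesgue_on \<Omega>) f" "AE x in lebesgue_on \<Omega>. 0 \<le> f x"
    and u: "weak_solution p \<delta> w \<Omega> \<A> f u" "u \<in> W1p_0 p w \<Omega>"
    and v: "weak_solution p \<delta> w \<Omega> \<A> f v" "v \<in> W1p_0 p w \<Omega>"
  shows "AE x in lebesgue_on \<Omega>. u x \<le> v x"
proof -

  \<comment> \<open>Subtraction of the two equations\<close>
  let ?M = "lebesgue_on \<Omega>"
  define z where "z x = u x - v x" for x
  define g where "g x = weak_grad \<Omega> u x - weak_grad \<Omega> v x" for x
  \<comment> \<open>\<open>F\<close> is the difference of the fluxes and \<open>k\<close> that of
    the singular right-hand sides; \<open>solves\<close> below is the subtracted equation.\<close>
  define F where "F x = \<A> x (weak_grad \<Omega> u x) - \<A> x (weak_grad \<Omega> v x)" for x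
  define k where "k x = f x / u x powr \<delta> - f x / v x powr \<delta>" for x
  have \<Omega>m: "\<Omega> \<inter> space lebesgue \<in> sets lebesgue" using \<Omega>(1) by auto
  have wi: "w locally_integrable_on \<Omega>"
    using Ap unfolding A_weight_def locally_integrable_on_def by blast
  have "AE x in lebesgue. 0 < w x" using Ap unfolding A_weight_def by blast
  then have w: "AE x in ?M. 0 < w x"
    by (subst AE_restrict_space_iff[OF \<Omega>m]) (auto elim: eventually_mono)
  then have w0: "AE x in ?M. 0 \<le> w x" by eventually_elim simp
  have wm: "w \<in> borel_measurable ?M" by (rule locally_integrable_on_measurable[OF \<Omega>(1) wi])
  have W: "u \<in> W1p p w \<Omega>" "v \<in> W1p p w \<Omega>" using u(2) v(2) by (simp_all add: W1p_0_def)
  have grm: "weak_grad \<Omega> s \<in> borel_measurable ?M" if "s \<in> W1p p w \<Omega>" for s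
    by (rule locally_integrable_on_measurable[OF \<Omega>(1) has_weak_gradientD(2)[OF W1pD(2)[OF that]]])
  have gm: "g \<in> borel_measurable ?M"
    unfolding g_def[abs_def] by (intro borel_measurable_diff grm W)
  have zm: "z \<in> borel_measurable ?M"
    unfolding z_def[abs_def] by (rule borel_measurable_diff[OF W1pD(1)[OF W(1)] W1pD(1)[OF W(2)]])
  have p0: "0 < p" using p by simp
  have gi: "integrable ?M (\<lambda>x. norm (g x) powr p * w x)"
    unfolding g_def by (rule weighted_diff(1)[OF p0 w0 grm[OF W(1)] grm[OF W(2)] wm W1pD(4)[OF W(1)] W1pD(4)[OF W(2)]])
  obtain \<zeta> :: "nat \<Rightarrow> 'a \<Rightarrow> real" where \<zeta>: "\<And>n. \<zeta> n \<in> Cc1 \<Omega>"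
    "AE x in ?M. (\<lambda>n. \<zeta> n x) \<longlonglongrightarrow> z x"
    "\<And>n. integrable ?M (\<lambda>x. norm (grad (\<zeta> n) x - g x) powr p * w x)"
    "(\<lambda>n. LINT x|?M. norm (grad (\<zeta> n) x - g x) powr p * w x) \<longlonglongrightarrow> 0"
    by (rule W1p_0_diff_approx[OF p0 \<Omega>(1) wi w u(2) v(2)], rule that, unfold z_def g_def)
  have cm: "\<psi> \<in> borel_measurable ?M" "grad \<psi> \<in> borel_measurable ?M" if "\<psi> \<in> Cc1 \<Omega>" for \<psi>
    by (intro locally_integrable_on_measurable[OF \<Omega>(1)] continuous_locally_integrable_on Cc1_gderiv(2,3)[OF that])+
  have dm: "(\<lambda>x. grad (\<zeta> n) x - g x) \<in> borel_measurable ?M" for n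
    by (intro borel_measurable_diff gm cm \<zeta>(1))
  have ci: "integrable ?M (\<lambda>x. norm (grad \<psi> x) powr p * w x)" if \<psi>: "\<psi> \<in> Cc1 \<Omega>" for \<psi>
  proof -
    obtain K where K: "compact K" "K \<subseteq> \<Omega>" "\<And>x. x \<notin> K \<Longrightarrow> \<psi> x = 0" "\<And>x. x \<notin> K \<Longrightarrow> grad \<psi> x = 0"
      by (rule Cc1_compact_support[OF \<psi>], rule that)
    show ?thesis by (rule weighted_Cc[OF p0 \<Omega>(1) wi Cc1_gderiv(2)[OF \<psi>] K(1,2,4)])
  qed
  note op = operator_integrable[OF p \<Omega>(1) w0 A]
  have Fi: "integrable ?M (\<lambda>x. F x \<bullet> d x)"
    if "d \<in> borel_measurable ?M" "integrable ?M (\<lambda>x. norm (d x) powr p * w x)" for d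
    unfolding F_def inner_diff_left
    by (rule Bochner_Integration.integrable_diff[OF op[OF W(1) that] op[OF W(2) that]])
  have ki: "integrable ?M (\<lambda>x. k x * \<psi> x)"
    and solves: "(LINT x|?M. F x \<bullet> grad \<psi> x) = (LINT x|?M. k x * \<psi> x)" if \<psi>: "\<psi> \<in> Cc1 \<Omega>" for \<psi>
  proof -
    have i: "integrable ?M (\<lambda>x. f x / s x powr \<delta> * \<psi> x)"
      and s: "(LINT x|?M. \<A> x (weak_grad \<Omega> s x) \<bullet> grad \<psi> x) = (LINT x|?M. f x / s x powr \<delta> * \<psi> x)"
      if "weak_solution p \<delta> w \<Omega> \<A> f s" "s \<in> W1p p w \<Omega>" for s
    proof -
      have "\<And>K. compactly_contained K \<Omega> \<Longrightarrow> \<exists>c>0. AE x in lebesgue. x \<in> K \<longrightarrow> s x \<ge> c"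
        using that(1) unfolding weak_solution_def by blast
      then show "integrable ?M (\<lambda>x. f x / s x powr \<delta> * \<psi> x)"
        by (rule singular_term_integrable[OF \<Omega>(1) \<delta> f(1) W1pD(1)[OF that(2)] _ \<psi>])
      show "(LINT x|?M. \<A> x (weak_grad \<Omega> s x) \<bullet> grad \<psi> x) = (LINT x|?M. f x / s x powr \<delta> * \<psi> x)"
        using that(1) \<psi> unfolding weak_solution_def by blast
    qed
    note i = i[OF u(1) W(1)] i[OF v(1) W(2)]
    show "integrable ?M (\<lambda>x. k x * \<psi> x)"
      unfolding k_def left_diff_distrib by (rule Bochner_Integration.integrable_diff[OF i])
    have "(LINT x|?M. F x \<bullet> grad \<psi> x) =
        (LINT x|?M. \<A> x (weak_grad \<Omega> u x) \<bullet> grad \<psi> x) - (LINT x|?M. \<A> x (weak_grad \<Omega> v x) \<bullet> grad \<psi> x)"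
      unfolding F_def inner_diff_left
      by (rule Bochner_Integration.integral_diff[OF op[OF W(1) cm(2)[OF \<psi>] ci[OF \<psi>]] op[OF W(2) cm(2)[OF \<psi>] ci[OF \<psi>]]])
    also have "\<dots> = (LINT x|?M. f x / u x powr \<delta> * \<psi> x) - (LINT x|?M. f x / v x powr \<delta> * \<psi> x)"
      unfolding s[OF u(1) W(1)] s[OF v(1) W(2)] ..
    also have "\<dots> = (LINT x|?M. k x * \<psi> x)"
      unfolding k_def left_diff_distrib by (rule Bochner_Integration.integral_diff[OF i, symmetric])
    finally show "(LINT x|?M. F x \<bullet> grad \<psi> x) = (LINT x|?M. k x * \<psi> x)" .
  qed

  \<comment> \<open>Convergence of the flux terms in L^1\<close>
  define q where "q n x = F x \<bullet> grad (\<zeta> n) x" for n x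
  define q' where "q' x = F x \<bullet> g x" for x
  have qi: "integrable ?M (q n)" for n
    unfolding q_def[abs_def] by (intro Fi cm(2) ci \<zeta>(1))
  have qi': "integrable ?M q'" unfolding q'_def[abs_def] by (intro Fi gm gi)
  have qlim: "(\<lambda>n. LINT x|?M. \<bar>q n x - q' x\<bar>) \<longlonglongrightarrow> 0"
  proof (rule tendsto_sandwich[OF _ _ tendsto_const])
    \<comment> \<open>The fluxes of \<open>u\<close> and of \<open>v\<close> are estimated
      separately, each against the gradient error of the approximants.\<close>
    let ?b = "\<lambda>s n. LINT x|?M. \<bar>\<A> x (weak_grad \<Omega> s x) \<bullet> (grad (\<zeta> n) x - g x)\<bar>"
    show "\<forall>\<^sub>F n in sequentially. 0 \<le> (LINT x|?M. \<bar>q n x - q' x\<bar>)" by simp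
    have "(LINT x|?M. \<bar>q n x - q' x\<bar>) \<le> ?b u n + ?b v n" for n
    proof -
      note o = op[OF W(1) dm \<zeta>(3), of n] op[OF W(2) dm \<zeta>(3), of n]
      have "(LINT x|?M. \<bar>q n x - q' x\<bar>) \<le> (LINT x|?M. \<bar>\<A> x (weak_grad \<Omega> u x) \<bullet> (grad (\<zeta> n) x - g x)\<bar>
          + \<bar>\<A> x (weak_grad \<Omega> v x) \<bullet> (grad (\<zeta> n) x - g x)\<bar>)"
      proof (rule integral_mono)
        show "integrable ?M (\<lambda>x. \<bar>q n x - q' x\<bar>)" using qi qi' by simp
        show "integrable ?M (\<lambda>x. \<bar>\<A> x (weak_grad \<Omega> u x) \<bullet> (grad (\<zeta> n) x - g x)\<bar>
          + \<bar>\<A> x (weak_grad \<Omega> v x) \<bullet> (grad (\<zeta> n) x - g x)\<bar>)" using o by simp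
        fix x
        have "q n x - q' x = \<A> x (weak_grad \<Omega> u x) \<bullet> (grad (\<zeta> n) x - g x)
            - \<A> x (weak_grad \<Omega> v x) \<bullet> (grad (\<zeta> n) x - g x)"
          by (simp add: q_def q'_def F_def inner_diff_left inner_diff_right)
        then show "\<bar>q n x - q' x\<bar> \<le> \<bar>\<A> x (weak_grad \<Omega> u x) \<bullet> (grad (\<zeta> n) x - g x)\<bar>
          + \<bar>\<A> x (weak_grad \<Omega> v x) \<bullet> (grad (\<zeta> n) x - g x)\<bar>" by linarith
      qed
      also have "\<dots> = ?b u n + ?b v n" using o by (intro Bochner_Integration.integral_add) simp_all
      finally show ?thesis .
    qed
    then show "\<forall>\<^sub>F n in sequentially. (LINT x|?M. \<bar>q n x - q' x\<bar>) \<le> ?b u n + ?b v n" by simp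
    have "(\<lambda>n. ?b u n + ?b v n) \<longlonglongrightarrow> 0 + 0"
      by (intro tendsto_add operator_tendsto_0[OF p \<Omega>(1) w0 A W(1) dm \<zeta>(3,4)]
        operator_tendsto_0[OF p \<Omega>(1) w0 A W(2) dm \<zeta>(3,4)])
    then show "(\<lambda>n. ?b u n + ?b v n) \<longlonglongrightarrow> 0" by simp
  qed

  \<comment> \<open>Cut-offs as test functions\<close>
  have \<zeta>m: "\<zeta> n \<in> borel_measurable ?M" for n by (intro cm \<zeta>(1))
  note sm = step_measurable[OF \<zeta>m] step_measurable[OF zm]
  have slim: "AE x in ?M. (\<lambda>n. step (\<zeta> n x)) \<longlonglongrightarrow> step (z x)"
    using \<zeta>(2) by eventually_elim (rule isCont_tendsto_compose[OF step_isCont(1)])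
  have dlim: "AE x in ?M. (\<lambda>n. dstep (\<zeta> n x)) \<longlonglongrightarrow> dstep (z x)"
    using \<zeta>(2) by eventually_elim (rule isCont_tendsto_compose[OF step_isCont(2)])
  have ss: "\<bar>step s\<bar> \<le> 1" "\<bar>dstep s\<bar> \<le> 2" for s using step_bounds[of s] by simp_all
  have sd: "\<bar>dstep s * step t\<bar> \<le> 2" for s t
    using mult_mono[OF ss(2)[of s] ss(1)[of t]] by (simp add: abs_mult)

  \<comment> \<open>The limit, as m tends to infinity, of the left-hand side tested with
    \<open>step (\<zeta> n x) * step (\<zeta> m x)\<close>. The first summand comes from
    differentiating the factor with m, the second from the factor with n.\<close>
  define E where "E n = (LINT x|?M. q' x * (dstep (z x) * step (\<zeta> n x))) +
    (LINT x|?M. q n x * (dstep (\<zeta> n x) * step (z x)))" for n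
  have E: "E n \<le> 0" for n
  proof -
    have lim0: "(\<lambda>m. LINT x|?M. \<bar>r x - r x\<bar>) \<longlonglongrightarrow> 0" for r :: "'a \<Rightarrow> real" by simp
    have L1: "(\<lambda>m. LINT x|?M. q m x * (dstep (\<zeta> m x) * step (\<zeta> n x)))
        \<longlonglongrightarrow> (LINT x|?M. q' x * (dstep (z x) * step (\<zeta> n x)))"
    proof (rule integral_mult_bounded_tendsto(3)[OF qi qi' qlim _ _ sd])
      show "AE x in ?M. (\<lambda>m. dstep (\<zeta> m x) * step (\<zeta> n x)) \<longlonglongrightarrow> dstep (z x) * step (\<zeta> n x)"
        using dlim by eventually_elim (rule tendsto_mult_right)
    qed (intro borel_measurable_times sm)+
    have I1: "integrable ?M (\<lambda>x. q m x * (dstep (\<zeta> m x) * step (\<zeta> n x)))" for m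
    proof (rule integral_mult_bounded_tendsto(1)[OF qi qi' qlim _ _ sd])
      show "AE x in ?M. (\<lambda>m. dstep (\<zeta> m x) * step (\<zeta> n x)) \<longlonglongrightarrow> dstep (z x) * step (\<zeta> n x)"
        using dlim by eventually_elim (rule tendsto_mult_right)
    qed (intro borel_measurable_times sm)+
    have l2: "AE x in ?M. (\<lambda>m. dstep (\<zeta> n x) * step (\<zeta> m x)) \<longlonglongrightarrow> dstep (\<zeta> n x) * step (z x)"
      using slim by eventually_elim (rule tendsto_mult_left)
    have L2: "(\<lambda>m. LINT x|?M. q n x * (dstep (\<zeta> n x) * step (\<zeta> m x)))
        \<longlonglongrightarrow> (LINT x|?M. q n x * (dstep (\<zeta> n x) * step (z x)))"
      by (rule integral_mult_bounded_tendsto(3)[OF qi qi lim0 _ _ sd l2]) (intro borel_measurable_times sm)+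
    have I2: "integrable ?M (\<lambda>x. q n x * (dstep (\<zeta> n x) * step (\<zeta> m x)))" for m
      by (rule integral_mult_bounded_tendsto(1)[OF qi qi lim0 _ _ sd l2]) (intro borel_measurable_times sm)+
    \<comment> \<open>With n fixed, this integrable function dominates the right-hand side for all
      m. A limit in both indices at once would lose the compact support that makes it
      integrable.\<close>
    have kn: "integrable ?M (\<lambda>x. k x * step (\<zeta> n x))" by (rule ki[OF Cc1_step(1)[OF \<zeta>(1)]])
    have R: "(\<lambda>m. LINT x|?M. (k x * step (\<zeta> n x)) * step (\<zeta> m x))
        \<longlonglongrightarrow> (LINT x|?M. (k x * step (\<zeta> n x)) * step (z x))"
      by (rule integral_mult_bounded_tendsto(3)[OF kn kn lim0 _ _ ss(1) slim]) (rule sm)+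
    have eq: "(LINT x|?M. q m x * (dstep (\<zeta> m x) * step (\<zeta> n x))) + (LINT x|?M. q n x * (dstep (\<zeta> n x) * step (\<zeta> m x)))
        = (LINT x|?M. (k x * step (\<zeta> n x)) * step (\<zeta> m x))" for m
    proof -
      let ?\<psi> = "\<lambda>x. step (\<zeta> n x) * step (\<zeta> m x)"
      have C: "C_diff 1 (\<lambda>x. step (\<zeta> n x))" using Cc1_step(1)[OF \<zeta>(1)] unfolding Cc1_def by blast
      note \<psi> = Cc1_mult[OF C Cc1_step(1)[OF \<zeta>(1)[of m]]]
      have gr: "F x \<bullet> grad ?\<psi> x = q m x * (dstep (\<zeta> m x) * step (\<zeta> n x)) + q n x * (dstep (\<zeta> n x) * step (\<zeta> m x))" for x
        unfolding \<psi>(2) Cc1_step(2)[OF \<zeta>(1)] by (simp add: q_def inner_add_right mult_ac)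
      show ?thesis
        using solves[OF \<psi>(1)] unfolding gr
        by (subst (asm) Bochner_Integration.integral_add[OF I1 I2]) (simp add: mult.assoc)
    qed
    have "E n = (LINT x|?M. (k x * step (\<zeta> n x)) * step (z x))"
      using tendsto_add[OF L1 L2] R unfolding eq E_def by (rule LIMSEQ_unique)
    also have "\<dots> \<le> 0"
    proof -
      have "AE x in ?M. 0 < u x" "AE x in ?M. 0 < v x"
        using u(1) v(1) unfolding weak_solution_def by blast+
      then have "AE x in ?M. 0 \<le> - ((k x * step (\<zeta> n x)) * step (z x))"
        using f(2)
      proof eventually_elim
        \<comment> \<open>Where z > 0, u > v > 0 makes \<open>k\<close> nonpositive; elsewhere the
          factor \<open>step (z x)\<close> vanishes.\<close>
        case (elim x)
        show ?case
        proof (cases "0 < z x")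
          case True
          then have "v x powr \<delta> \<le> u x powr \<delta>"
            using elim \<delta> by (intro powr_mono2) (simp_all add: z_def)
          then have "f x / u x powr \<delta> \<le> f x / v x powr \<delta>"
            using elim by (intro frac_le) simp_all
          then have "k x \<le> 0" by (simp add: k_def)
          then have "(k x * step (\<zeta> n x)) * step (z x) \<le> 0"
            by (intro mult_nonpos_nonneg step_bounds(1))
          then show ?thesis by simp
        qed (simp add: step_nonpos)
      qed
      then have "0 \<le> (LINT x|?M. - ((k x * step (\<zeta> n x)) * step (z x)))"
        by (rule integral_nonneg_AE)
      then show ?thesis by simp
    qed
    finally show ?thesis .
  qed

  \<comment> \<open>The gradient of z vanishes where z is positive\<close>
  have zs1: "AE x in ?M. (\<lambda>n. dstep (\<zeta> n x) * step (z x)) \<longlonglongrightarrow> dstep (z x) * step (z x)"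
    using dlim by eventually_elim (rule tendsto_mult_right)
  have zs2: "AE x in ?M. (\<lambda>n. dstep (z x) * step (\<zeta> n x)) \<longlonglongrightarrow> dstep (z x) * step (z x)"
    using slim by eventually_elim (rule tendsto_mult_left)
  have qq0: "(\<lambda>m::nat. LINT x|?M. \<bar>q' x - q' x\<bar>) \<longlonglongrightarrow> 0" by simp
  \<comment> \<open>Both summands of \<open>E\<close> have the same limit, so twice that integral is
    nonpositive.\<close>
  have "E \<longlonglongrightarrow> (LINT x|?M. q' x * (dstep (z x) * step (z x))) + (LINT x|?M. q' x * (dstep (z x) * step (z x)))"
    unfolding E_def[abs_def]
  proof (rule tendsto_add)
    show "(\<lambda>n. LINT x|?M. q' x * (dstep (z x) * step (\<zeta> n x))) \<longlonglongrightarrow> (LINT x|?M. q' x * (dstep (z x) * step (z x)))"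
      by (rule integral_mult_bounded_tendsto(3)[OF qi' qi' qq0 _ _ sd zs2]) (intro borel_measurable_times sm)+
    show "(\<lambda>n. LINT x|?M. q n x * (dstep (\<zeta> n x) * step (z x))) \<longlonglongrightarrow> (LINT x|?M. q' x * (dstep (z x) * step (z x)))"
      by (rule integral_mult_bounded_tendsto(3)[OF qi qi' qlim _ _ sd zs1]) (intro borel_measurable_times sm)+
  qed
  then have "(LINT x|?M. q' x * (dstep (z x) * step (z x))) + (LINT x|?M. q' x * (dstep (z x) * step (z x))) \<le> 0"
    by (rule LIMSEQ_le_const2) (use E in blast)
  then have le0: "(LINT x|?M. q' x * (dstep (z x) * step (z x))) \<le> 0" by simp
  have Ii: "integrable ?M (\<lambda>x. q' x * (dstep (z x) * step (z x)))"
    by (rule integral_mult_bounded_tendsto(2)[OF qi' qi' qq0 _ _ sd zs2]) (intro borel_measurable_times sm)+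
  have strict: "AE x in ?M. g x \<noteq> 0 \<longrightarrow> 0 < q' x"
    using structural_conditions_strict[OF A w]
  proof eventually_elim
    case (elim x)
    show ?case using elim[rule_format, of "weak_grad \<Omega> u x" "weak_grad \<Omega> v x"]
      by (auto simp: q'_def F_def g_def)
  qed
  have nn: "AE x in ?M. 0 \<le> q' x * (dstep (z x) * step (z x))"
    using strict
  proof eventually_elim
    case (elim x)
    have "0 \<le> q' x" using elim by (cases "g x = 0") (auto simp: q'_def)
    then show ?case by (intro mult_nonneg_nonneg step_bounds)
  qed
  then have "(LINT x|?M. q' x * (dstep (z x) * step (z x))) = 0"
    using integral_nonneg_AE[OF nn] le0 by simp
  then have "AE x in ?M. q' x * (dstep (z x) * step (z x)) = 0"
    using integral_nonneg_eq_0_iff_AE[OF Ii nn] by simp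
  \<comment> \<open>With the factor \<open>dstep\<close> the conclusion covers the points with z
    \<le> 0 too, and this product is what the limit of the gradients of the cut-offs
    contains.\<close>
  then have g0: "AE x in ?M. dstep (z x) *\<^sub>R g x = 0"
    using strict
  proof eventually_elim
    case (elim x)
    show ?case
    proof (cases "0 < z x")
      case True
      then have "q' x = 0" using elim(1) step_pos[of "z x"] by simp
      then have "g x = 0" using elim(2) by auto
      then show ?thesis by simp
    qed (simp add: step_nonpos)
  qed

  \<comment> \<open>From the vanishing gradient to z \<le> 0\<close>
  obtain b :: 'a where b: "b \<in> Basis" using nonempty_Basis by blast
  then have nb: "norm b = 1" by simp
  have Di: "integrable ?M (\<lambda>x. (grad (\<zeta> n) x - g x) \<bullet> b)"
    and Dlim: "(\<lambda>n. LINT x|?M. \<bar>(grad (\<zeta> n) x - g x) \<bullet> b\<bar>) \<longlonglongrightarrow> 0" for n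
  proof -
    \<comment> \<open>With this choice H^(p-1) w = 1, so the product bound controls the unweighted
      gradient error, and H^p w = H is integrable by the A_p condition.\<close>
    let ?H = "\<lambda>x. w x powr (- 1 / (p - 1))"
    have H: "0 \<le> ?H x" for x by simp
    have m: "(\<lambda>x. (grad (\<zeta> n) x - g x) \<bullet> b) \<in> borel_measurable ?M" for n
      by (intro borel_measurable_inner dm) simp
    have bd: "AE x in ?M. \<bar>(grad (\<zeta> n) x - g x) \<bullet> b\<bar> \<le> ?H x powr (p - 1) * norm (grad (\<zeta> n) x - g x) * w x" for n
      using w
    proof eventually_elim
      case (elim x)
      have "?H x powr (p - 1) = w x powr - 1"
        unfolding powr_powr using p by simp
      then have "?H x powr (p - 1) * w x = 1"
        using elim by (simp add: powr_minus)
      moreover have "\<bar>(grad (\<zeta> n) x - g x) \<bullet> b\<bar> \<le> norm (grad (\<zeta> n) x - g x)"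
        using Cauchy_Schwarz_ineq2[of "grad (\<zeta> n) x - g x" b] nb by simp
      moreover have "?H x powr (p - 1) * norm (grad (\<zeta> n) x - g x) * w x =
          (?H x powr (p - 1) * w x) * norm (grad (\<zeta> n) x - g x)" by (simp only: mult_ac)
      ultimately show ?case by (simp only: mult_1)
    qed
    have eqH: "AE x in ?M. ?H x = ?H x powr p * w x"
      using w
    proof eventually_elim
      case (elim x)
      have "?H x powr p * w x = w x powr (- 1 / (p - 1) * p + 1)"
        unfolding powr_powr powr_add using elim by simp
      moreover have "- 1 / (p - 1) * p + 1 = - 1 / (p - 1)" using p by (simp add: field_simps)
      ultimately show ?case by simp
    qed
    have HI: "integrable ?M (\<lambda>x. ?H x powr p * w x)"
      by (rule integrable_cong_AE_imp[OF A_weight_dual_integrable[OF Ap \<Omega>] _ eqH]) (use wm in measurable)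
    show "integrable ?M (\<lambda>x. (grad (\<zeta> n) x - g x) \<bullet> b)"
      by (rule weighted_product_bound(1)[OF p w0 H norm_ge_zero m bd HI \<zeta>(3)])
    show "(\<lambda>n. LINT x|?M. \<bar>(grad (\<zeta> n) x - g x) \<bullet> b\<bar>) \<longlonglongrightarrow> 0"
      by (rule weighted_product_tendsto_0[OF p w0 H norm_ge_zero m bd HI \<zeta>(3,4)])
  qed
  have ri: "integrable ?M (\<lambda>x. grad (\<zeta> n) x \<bullet> b)" for n
  proof -
    obtain K where K: "compact K" "K \<subseteq> \<Omega>" "\<And>x. x \<notin> K \<Longrightarrow> \<zeta> n x = 0" "\<And>x. x \<notin> K \<Longrightarrow> grad (\<zeta> n) x = 0"
      by (rule Cc1_compact_support[OF \<zeta>(1)], rule that)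
    show ?thesis
      by (rule continuous_compact_support_integral(2)[OF _ K(1,2) _ \<Omega>(1)])
        (intro continuous_intros Cc1_gderiv(2)[OF \<zeta>(1)], simp add: K(4))
  qed
  \<comment> \<open>Any one approximant suffices here; index 0 is taken.\<close>
  have ri': "integrable ?M (\<lambda>x. g x \<bullet> b)"
    using Bochner_Integration.integrable_diff[OF ri[of 0] Di[of 0]] by (simp add: inner_diff_left)
  have rlim: "(\<lambda>n. LINT x|?M. \<bar>grad (\<zeta> n) x \<bullet> b - g x \<bullet> b\<bar>) \<longlonglongrightarrow> 0"
    using Dlim by (simp add: inner_diff_left)
  obtain R where R: "0 < R" "\<And>x. x \<in> \<Omega> \<Longrightarrow> norm x \<le> R"
    using \<Omega>(2) by (auto simp: bounded_pos)
  have xm: "(\<lambda>x. x \<bullet> b) \<in> borel_measurable ?M"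
    by (intro locally_integrable_on_measurable[OF \<Omega>(1)] continuous_locally_integrable_on continuous_intros)
  \<comment> \<open>By \<open>integral_Cc1\<close> these integrals are the negatives of those of
    \<open>step (\<zeta> n x)\<close>. The factor x . b is bounded because \<Omega> is.\<close>
  have "(\<lambda>n. LINT x|?M. (grad (\<zeta> n) x \<bullet> b) * ((x \<bullet> b) * dstep (\<zeta> n x)))
      \<longlonglongrightarrow> (LINT x|?M. (g x \<bullet> b) * ((x \<bullet> b) * dstep (z x)))"
  proof (rule integral_mult_bounded_tendsto(3)[OF ri ri' rlim])
    show "\<bar>(x \<bullet> b) * dstep (\<zeta> n x)\<bar> \<le> R * 2" if "x \<in> space ?M" for n x
    proof -
      have "\<bar>x \<bullet> b\<bar> \<le> R"
        using Cauchy_Schwarz_ineq2[of x b] nb R(2)[of x] that by simp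
      then show ?thesis unfolding abs_mult using ss(2) R(1) by (intro mult_mono) simp_all
    qed
    show "AE x in ?M. (\<lambda>n. (x \<bullet> b) * dstep (\<zeta> n x)) \<longlonglongrightarrow> (x \<bullet> b) * dstep (z x)"
      using dlim by eventually_elim (rule tendsto_mult_left)
  qed (intro borel_measurable_times xm sm)+
  moreover have "(LINT x|?M. (g x \<bullet> b) * ((x \<bullet> b) * dstep (z x))) = 0"
  proof (rule integral_eq_zero_AE)
    show "AE x in ?M. (g x \<bullet> b) * ((x \<bullet> b) * dstep (z x)) = 0"
      using g0 by eventually_elim auto
  qed
  moreover have "(LINT x|?M. step (\<zeta> n x)) = - (LINT x|?M. (grad (\<zeta> n) x \<bullet> b) * ((x \<bullet> b) * dstep (\<zeta> n x)))" for n
    unfolding integral_Cc1[OF \<Omega>(1) Cc1_step(1)[OF \<zeta>(1)] nb] Cc1_step(2)[OF \<zeta>(1)]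
    by (simp add: mult_ac)
  ultimately have S0: "(\<lambda>n. LINT x|?M. step (\<zeta> n x)) \<longlonglongrightarrow> 0"
    using tendsto_minus by fastforce
  have fin: "finite_measure ?M"
    by (intro finite_measure_lebesgue_on bounded_set_imp_lmeasurable \<Omega>(2)) (use \<Omega>(1) in auto)
  have one: "integrable ?M (\<lambda>x. 1::real)" by (rule finite_measure.integrable_const[OF fin])
  have one0: "(\<lambda>n::nat. LINT x|?M. \<bar>1 - 1 :: real\<bar>) \<longlonglongrightarrow> 0" by simp
  \<comment> \<open>With the constant 1 as integrable factor, this is bounded convergence on the
    finite measure space \<Omega>, so the integral of \<open>step (z x)\<close> is the limit 0 found
    above.\<close>
  note st = integral_mult_bounded_tendsto(2,3)[OF one one one0 sm(1) sm(3) ss(1) slim]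
  have "(LINT x|?M. step (z x)) = 0"
    using st(2) S0 by (simp add: LIMSEQ_unique)
  moreover have "integrable ?M (\<lambda>x. step (z x))" using st(1) by simp
  ultimately have "AE x in ?M. step (z x) = 0"
    using integral_nonneg_eq_0_iff_AE[of ?M "\<lambda>x. step (z x)"] step_bounds(1) by simp
  then show ?thesis
  proof eventually_elim
    case (elim x)
    then have "\<not> 0 < z x" using step_pos(1)[of "z x"] by auto
    then show ?case by (simp add: z_def)
  qed
qed

theorem theorem4p1:
  fixes \<Omega> :: "(real ^ 'n) set" and p \<delta> :: real
    and w f u v :: "real ^ 'n \<Rightarrow> real"
    and \<A> :: "real ^ 'n \<Rightarrow> real ^ 'n \<Rightarrow> real ^ 'n"
  assumes "CARD('n) \<ge> 2"
    and "bounded_smooth_domain \<Omega>"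
    and "1 < p"
    and "0 < \<delta>" and "\<delta> \<le> 1"
    and "A_weight p w"
    and "structural_conditions p w \<Omega> \<A>"
    and "integrable (lebesgue_on \<Omega>) f"
    and "AE x in lebesgue_on \<Omega>. f x \<ge> 0"
    and "\<not> (AE x in lebesgue_on \<Omega>. f x = 0)"
    and "weak_solution p \<delta> w \<Omega> \<A> f u" and "u \<in> W1p_0 p w \<Omega>"
    and "weak_solution p \<delta> w \<Omega> \<A> f v" and "v \<in> W1p_0 p w \<Omega>"
  shows "AE x in lebesgue_on \<Omega>. u x = v x"
proof -
  have \<Omega>: "open \<Omega>" "bounded \<Omega>" using assms(2) by (simp_all add: bounded_smooth_domain_def)
  note le = weak_solutions_le[OF \<Omega> assms(3,4,6,7,8,9)]
  show ?thesis
    using le[OF assms(11-14)] le[OF assms(13,14,11,12)] by eventually_elim simp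
qed

end
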